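(* Let $T$ be polynomial in $n$ and let $\hat\rho=(\hat\rho_1,\ldots,\hat\rho_T)$ be a $d$-delayed prediction for Erickson's problem. (i) There is an algorithm solving Erickson's problem given $\hat\rho$ with polynomial preprocessing time $P(n)$, update time $U(n)=\tilde O(d)$ and query time $Q(n)=\tilde O(1)$. (ii) There is an algorithm solving Erickson's problem given $\hat\rho$ with polynomial preprocessing time $P(n)$, update time $U(n)=\tilde O(1)$ and query time $Q(n)=\tilde O(d^2)$.
   Context: Erickson's maximum value problem: an initial $n\times n$ matrix $M_0$ is given; each update increments all entries of a given row or of a given column by $1$; each query asks for the maximum entry of the current matrix. Requests arrive online and queries must be answered before the next request. A permutation $\pi$ of $[T]$ acts by $\pi(\rho)=(\rho_{\pi(1)},\ldots,\rho_{\pi(T)})$ and is $d$-close to the identity if $|\pi^{-1}(t)-t|\le d$ for all $t$; $\hat\rho$ is $d$-delayed for the actual request sequence $\rho$ if $\pi(\rho)=\hat\rho$ for some such $\pi$. $\tilde O$ hides polylogarithmic factors. *)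

theory Defs
  imports Complex_Main "HOL-Combinatorics.Permutations"
begin

section \<open>Erickson's maximum value problem\<close>

text \<open>
  A matrix is a function of which only the entries with indices \<open>i, j < n\<close> matter; rows, columns
  and positions in request sequences are numbered from \<open>0\<close>.
\<close>

type_synonym matrix = "nat \<Rightarrow> nat \<Rightarrow> int"

datatype request = IncRow nat | IncCol nat | Query

fun valid_request :: "nat \<Rightarrow> request \<Rightarrow> bool" where
  "valid_request n (IncRow i) \<longleftrightarrow> i < n"
| "valid_request n (IncCol j) \<longleftrightarrow> j < n"
| "valid_request n Query \<longleftrightarrow> True"

fun apply_request :: "request \<Rightarrow> matrix \<Rightarrow> matrix" where
  "apply_request (IncRow i) M = (\<lambda>a b. if a = i then M a b + 1 else M a b)"
| "apply_request (IncCol j) M = (\<lambda>a b. if b = j then M a b + 1 else M a b)"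
| "apply_request Query M = M"

definition max_entry :: "nat \<Rightarrow> matrix \<Rightarrow> int" where
  "max_entry n M = Max {M i j | i j. i < n \<and> j < n}"

definition close_to_id :: "nat \<Rightarrow> nat \<Rightarrow> (nat \<Rightarrow> nat) \<Rightarrow> bool" where
  "close_to_id T d \<pi> \<longleftrightarrow> \<pi> permutes {..<T} \<and> (\<forall>t<T. \<bar>int (inv \<pi> t) - int t\<bar> \<le> int d)"

text \<open>\<open>delayed d \<rho> \<rho>'\<close>: the prediction \<open>\<rho>'\<close> is \<open>d\<close>-delayed for the actual sequence \<open>\<rho>\<close>.\<close>

definition delayed :: "nat \<Rightarrow> request list \<Rightarrow> request list \<Rightarrow> bool" where
  "delayed d \<rho> \<rho>' \<longleftrightarrow> (\<exists>\<pi>. close_to_id (length \<rho>) d \<pi> \<and> permute_list \<pi> \<rho> = \<rho>')"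


section \<open>Word RAM programs\<close>

text \<open>
  Algorithms are programs of a structured random access machine. The memory consists of named
  arrays of words; a program mentions finitely many of them, so interleaving them gives an ordinary
  linear memory. Scalars are kept in cell \<open>0\<close> of an array.

  The word size is given by the largest absolute value \<open>W\<close> of a word: a command has an
  execution only if all intermediate values (addresses included) fit into a word. Every operation
  on words, memory access and control step costs one unit of time.
\<close>

type_synonym name = string
type_synonym state = "name \<Rightarrow> int \<Rightarrow> int"

datatype aexp =
    Const int
  | Read name aexp
  | Plus aexp aexp
  | Minus aexp aexp
  | Times aexp aexp

datatype test = Less aexp aexp | Equal aexp aexp

datatype com =
    Skip
  | Assign name aexp aexp  \<comment> \<open>\<open>Assign x i e\<close> is \<open>x[i] := e\<close>\<close>
  | Seq com com
  | If test com com
  | While test com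

fun aval :: "aexp \<Rightarrow> state \<Rightarrow> int" where
  "aval (Const c) s = c"
| "aval (Read x i) s = s x (aval i s)"
| "aval (Plus a b) s = aval a s + aval b s"
| "aval (Minus a b) s = aval a s - aval b s"
| "aval (Times a b) s = aval a s * aval b s"

fun afits :: "int \<Rightarrow> aexp \<Rightarrow> state \<Rightarrow> bool" where
  "afits W (Const c) s \<longleftrightarrow> \<bar>c\<bar> \<le> W"
| "afits W (Read x i) s \<longleftrightarrow> afits W i s \<and> \<bar>aval (Read x i) s\<bar> \<le> W"
| "afits W (Plus a b) s \<longleftrightarrow> afits W a s \<and> afits W b s \<and> \<bar>aval (Plus a b) s\<bar> \<le> W"
| "afits W (Minus a b) s \<longleftrightarrow> afits W a s \<and> afits W b s \<and> \<bar>aval (Minus a b) s\<bar> \<le> W"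
| "afits W (Times a b) s \<longleftrightarrow> afits W a s \<and> afits W b s \<and> \<bar>aval (Times a b) s\<bar> \<le> W"

fun acost :: "aexp \<Rightarrow> nat" where
  "acost (Const c) = 1"
| "acost (Read x i) = acost i + 1"
| "acost (Plus a b) = acost a + acost b + 1"
| "acost (Minus a b) = acost a + acost b + 1"
| "acost (Times a b) = acost a + acost b + 1"

fun tval :: "test \<Rightarrow> state \<Rightarrow> bool" where
  "tval (Less a b) s \<longleftrightarrow> aval a s < aval b s"
| "tval (Equal a b) s \<longleftrightarrow> aval a s = aval b s"

fun tfits :: "int \<Rightarrow> test \<Rightarrow> state \<Rightarrow> bool" where
  "tfits W (Less a b) s \<longleftrightarrow> afits W a s \<and> afits W b s"
| "tfits W (Equal a b) s \<longleftrightarrow> afits W a s \<and> afits W b s"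

fun tcost :: "test \<Rightarrow> nat" where
  "tcost (Less a b) = acost a + acost b + 1"
| "tcost (Equal a b) = acost a + acost b + 1"

text \<open>
  \<open>exec W c s k s'\<close>: with words bounded by \<open>W\<close>, command \<open>c\<close> started in state \<open>s\<close> terminates after
  \<open>k\<close> time units in state \<open>s'\<close>.
\<close>

inductive exec :: "int \<Rightarrow> com \<Rightarrow> state \<Rightarrow> nat \<Rightarrow> state \<Rightarrow> bool" for W where
  Skip: "exec W Skip s 1 s"
| Assign: "afits W i s \<Longrightarrow> afits W e s \<Longrightarrow>
    exec W (Assign x i e) s (acost i + acost e + 1) (s(x := (s x)(aval i s := aval e s)))"
| Seq: "exec W c1 s k1 s1 \<Longrightarrow> exec W c2 s1 k2 s2 \<Longrightarrow> exec W (Seq c1 c2) s (k1 + k2) s2"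
| IfTrue: "tfits W b s \<Longrightarrow> tval b s \<Longrightarrow> exec W c1 s k s' \<Longrightarrow>
    exec W (If b c1 c2) s (tcost b + k + 1) s'"
| IfFalse: "tfits W b s \<Longrightarrow> \<not> tval b s \<Longrightarrow> exec W c2 s k s' \<Longrightarrow>
    exec W (If b c1 c2) s (tcost b + k + 1) s'"
| WhileFalse: "tfits W b s \<Longrightarrow> \<not> tval b s \<Longrightarrow> exec W (While b c) s (tcost b + 1) s"
| WhileTrue: "tfits W b s \<Longrightarrow> tval b s \<Longrightarrow> exec W c s k1 s1 \<Longrightarrow> exec W (While b c) s1 k2 s2 \<Longrightarrow>
    exec W (While b c) s (tcost b + k1 + k2 + 1) s2"

text \<open>Executions are deterministic, so outcome and running time are functions of the start state.\<close>

lemma exec_deterministic: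
  "exec W c s k s' \<Longrightarrow> exec W c s l s'' \<Longrightarrow> l = k \<and> s'' = s'"
proof (induction arbitrary: l s'' rule: exec.induct)
  case (Skip s)
  then show ?case by (cases rule: exec.cases) auto
next
  case (Assign i s e x)
  from Assign.prems show ?case by (cases rule: exec.cases) auto
next
  case (Seq c1 s k1 s1 c2 k2 s2)
  from Seq.prems show ?case by (cases rule: exec.cases) (use Seq.IH in blast)+
next
  case (IfTrue b s c1 k s' c2)
  from IfTrue.prems show ?case by (cases rule: exec.cases) (use IfTrue in blast)+
next
  case (IfFalse b s c2 k s' c1)
  from IfFalse.prems show ?case by (cases rule: exec.cases) (use IfFalse in blast)+
next
  case (WhileFalse b s c)
  from WhileFalse.prems show ?case by (cases rule: exec.cases) (use WhileFalse in blast)+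
next
  case (WhileTrue b s c k1 s1 k2 s2)
  from WhileTrue.prems show ?case by (cases rule: exec.cases) (use WhileTrue in blast)+
qed


section \<open>Algorithms with predictions for Erickson's problem\<close>

fun request_kind :: "request \<Rightarrow> int" where
  "request_kind Query = 0"
| "request_kind (IncRow i) = 1"
| "request_kind (IncCol j) = 2"

fun request_index :: "request \<Rightarrow> int" where
  "request_index Query = 0"
| "request_index (IncRow i) = int i"
| "request_index (IncCol j) = int j"

text \<open>The matrix is stored in row-major order; cells that hold no input are \<open>0\<close>.\<close>

definition input_state :: "nat \<Rightarrow> nat \<Rightarrow> matrix \<Rightarrow> request list \<Rightarrow> state" where
  "input_state n d M \<rho>' = (\<lambda>_ _. 0)
     (''n'' := (\<lambda>_. 0)(0 := int n),
      ''d'' := (\<lambda>_. 0)(0 := int d),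
      ''T'' := (\<lambda>_. 0)(0 := int (length \<rho>')),
      ''matrix'' := (\<lambda>a. if 0 \<le> a \<and> a < int n * int n then M (nat a div n) (nat a mod n) else 0),
      ''pred_kind'' :=
         (\<lambda>a. if 0 \<le> a \<and> a < int (length \<rho>') then request_kind (\<rho>' ! nat a) else 0),
      ''pred_index'' :=
         (\<lambda>a. if 0 \<le> a \<and> a < int (length \<rho>') then request_index (\<rho>' ! nat a) else 0))"

definition receive :: "request \<Rightarrow> state \<Rightarrow> state" where
  "receive r s = s
     (''kind'' := (s ''kind'')(0 := request_kind r),
      ''index'' := (s ''index'')(0 := request_index r))"

text \<open>
  \<open>serves W upd qry u q n M s \<rho>\<close>: if the current matrix is \<open>M\<close> and the current memory is \<open>s\<close>, then
  the handlers \<open>upd\<close> and \<open>qry\<close> process the requests \<open>\<rho>\<close> one after the other, each update within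
  time \<open>u\<close> and each query within time \<open>q\<close>, and leave the correct answer of each query in cell
  \<open>''out'' 0\<close>. A handler sees only the memory and the current request, never later requests.
\<close>

fun serves :: "int \<Rightarrow> com \<Rightarrow> com \<Rightarrow> real \<Rightarrow> real \<Rightarrow> nat \<Rightarrow> matrix \<Rightarrow> state \<Rightarrow> request list \<Rightarrow> bool" where
  "serves W upd qry u q n M s [] \<longleftrightarrow> True"
| "serves W upd qry u q n M s (Query # \<rho>) \<longleftrightarrow>
     (\<exists>k s'. exec W qry (receive Query s) k s' \<and> real k \<le> q \<and> s' ''out'' 0 = max_entry n M \<and>
        serves W upd qry u q n M s' \<rho>)"
| "serves W upd qry u q n M s (r # \<rho>) \<longleftrightarrow>
     (\<exists>k s'. exec W upd (receive r s) k s' \<and> real k \<le> u \<and>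
        serves W upd qry u q n (apply_request r M) s' \<rho>)"

text \<open>
  The program consisting of the preprocessing \<open>pre\<close> and the handlers \<open>upd\<close> and \<open>qry\<close> solves
  Erickson's problem for \<open>T n\<close> requests, given a \<open>d\<close>-delayed prediction \<open>\<rho>'\<close>, with worst-case times
  \<open>P n\<close>, \<open>U n d\<close> and \<open>Q n d\<close>. The bound \<open>K * (n + d + B) ^ K\<close> says that words have \<open>O(log N)\<close>
  bits, where \<open>N\<close> bounds \<open>n\<close>, \<open>d\<close> and the absolute values of the entries of \<open>M\<close>; the times must not
  depend on the size of the entries.
\<close>

definition solves_erickson ::
  "(nat \<Rightarrow> nat) \<Rightarrow> com \<Rightarrow> com \<Rightarrow> com \<Rightarrow> (nat \<Rightarrow> real) \<Rightarrow> (nat \<Rightarrow> nat \<Rightarrow> real) \<Rightarrow> (nat \<Rightarrow> nat \<Rightarrow> real) \<Rightarrow> bool"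
where
  "solves_erickson T pre upd qry P U Q \<longleftrightarrow>
     (\<exists>K::nat. \<forall>n\<ge>1. \<forall>d B. \<forall>M :: matrix. \<forall>\<rho>'.
        (\<forall>i<n. \<forall>j<n. \<bar>M i j\<bar> \<le> int B) \<and> length \<rho>' = T n \<and> (\<forall>r\<in>set \<rho>'. valid_request n r) \<longrightarrow>
        (let W = int (K * (n + d + B) ^ K) in
         \<exists>k s. exec W pre (input_state n d M \<rho>') k s \<and> real k \<le> P n \<and>
           (\<forall>\<rho>. delayed d \<rho> \<rho>' \<longrightarrow> serves W upd qry (U n d) (Q n d) n M s \<rho>)))"


section \<open>Growth rates\<close>

definition polynomially_bounded :: "(nat \<Rightarrow> real) \<Rightarrow> bool" where
  "polynomially_bounded f \<longleftrightarrow> (\<exists>k::nat. \<forall>n\<ge>1. f n \<le> real k * real n ^ k)"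

text \<open>
  Bounds up to a factor polylogarithmic in \<open>n\<close>, uniformly in the delay \<open>d\<close>. Since \<open>d = 0\<close> is allowed and
  every operation takes some time, a bound \<open>d\<close> is to be written as \<open>max 1 d\<close>.
\<close>

definition soft_O :: "(nat \<Rightarrow> nat \<Rightarrow> real) \<Rightarrow> (nat \<Rightarrow> nat \<Rightarrow> real) set" where
  "soft_O g = {f. \<exists>(C::real) k::nat. \<forall>n\<ge>1. \<forall>d. f n d \<le> C * g n d * (1 + log 2 (real n)) ^ k}"

end

theory Submission
  imports Defs
begin

text \<open>
  An entry of the current matrix is its initial value plus the number of increments of its row and
  of its column. After \<open>t\<close> requests the first \<open>t - d\<close> predicted requests have certainly arrived, and
  everything that has arrived is among the first \<open>t + d\<close> predicted ones. So the counts of the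
  predicted prefix of length \<open>t - d\<close> are lower bounds for the current counts, and they are exact for
  every row and column not mentioned in the window of the at most \<open>2d\<close> predicted requests in between.
  The preprocessing tabulates, for every prefix of the prediction, the row maxima taken with the
  column counts of the prefix, the column maxima taken with its row counts, and the overall maximum.

  (i) The maximum never decreases, and incrementing a row can only raise it to an entry of that row:
  either one in a column of the window, or one that is covered by the tabulated row maximum.

  (ii) A query compares the tabulated overall maximum, the tabulated maxima of the rows and columns of
  the window, and the entries at the crossings of these rows and columns.
\<close>

section \<open>Weakest preconditions with running times\<close>

text \<open>The decomposition pays off because entries are additive: a row maximum needs only column
  counts, so the count of the row itself can be added later from the exact counter that the handlers
  keep. Staleness then affects only the other coordinate. Since stale counts err only downwards,
  every candidate value is at most the true maximum, and correctness of a handler reduces to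
  covering all entries by candidates. Uncertainty concerns only the position of the window, not the
  set of requests that arrived within it; hence one table row per prefix is enough,
  \<open>(T + 1) * n\<close> cells per table, which is polynomial because \<open>T\<close> is. All
  tables are read by direct access, so no logarithmic factor arises: only the scan of the window
  costs time, once for an update and over pairs for a query. The rest of the work is dictated by the
  machine model: each intermediate value and address must be shown to fit into a word, and time must
  be counted explicitly.\<close>

text \<open>A total-correctness reading with the running time handed to the postcondition. As
  \<open>exec\<close> is deterministic, asking for some execution is asking about the only
  one.\<close>

definition wp :: "int \<Rightarrow> com \<Rightarrow> (nat \<Rightarrow> state \<Rightarrow> bool) \<Rightarrow> state \<Rightarrow> bool" where
  "wp W c Q s \<longleftrightarrow> (\<exists>k s'. exec W c s k s' \<and> Q k s')"

inductive_cases SkipE: "exec W Skip s k s'"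
inductive_cases AssignE: "exec W (Assign x i e) s k s'"
inductive_cases SeqE: "exec W (Seq c1 c2) s k s'"
inductive_cases IfE: "exec W (If b c1 c2) s k s'"

lemma wp_Skip: "wp W Skip Q s \<longleftrightarrow> Q 1 s"
  unfolding wp_def by (metis SkipE exec.Skip)

lemma wp_Assign:
  "wp W (Assign x i e) Q s \<longleftrightarrow> afits W i s \<and> afits W e s \<and>
     Q (acost i + acost e + 1) (s(x := (s x)(aval i s := aval e s)))"
  unfolding wp_def by (metis AssignE exec.Assign)

text \<open>Stated without the state argument: after one rewriting the second command sits inside a
  postcondition as an unapplied predicate and must still be rewritable there.\<close>

lemma wp_Seq: "wp W (Seq c1 c2) Q = wp W c1 (\<lambda>k1. wp W c2 (\<lambda>k2. Q (k1 + k2)))"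
  unfolding wp_def by (rule ext) (metis SeqE exec.Seq)

lemma wp_If:
  "wp W (If b c1 c2) Q s \<longleftrightarrow> tfits W b s \<and>
     wp W (if tval b s then c1 else c2) (\<lambda>k. Q (tcost b + k + 1)) s" (is "?L \<longleftrightarrow> ?R")
proof
  assume ?L
  then show ?R unfolding wp_def by (auto elim!: IfE)
next
  assume ?R
  then obtain k s' where *: "tfits W b s" "exec W (if tval b s then c1 else c2) s k s'"
      "Q (tcost b + k + 1) s'"
    unfolding wp_def by blast
  have "exec W (If b c1 c2) s (tcost b + k + 1) s'"
  proof (cases "tval b s")
    case True
    then show ?thesis using * by (intro exec.IfTrue) simp_all
  next
    case False
    then show ?thesis using * by (intro exec.IfFalse) simp_all
  qed
  with * show ?L unfolding wp_def by blast
qed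

lemma wp_mono: "wp W c Q s \<Longrightarrow> (\<And>k s'. Q k s' \<Longrightarrow> Q' k s') \<Longrightarrow> wp W c Q' s"
  unfolding wp_def by blast

text \<open>A rule for counting loops: the invariant is indexed by the counter, so termination needs
  no separate measure. Induction goes downwards from \<open>hi\<close>, since the run from
  \<open>j\<close> contains the run from \<open>Suc j\<close>. The trailing
  \<open>tcost b + 1\<close> pays for the failing last test.\<close>

lemma wp_While:
  assumes init: "I lo s" and "lo \<le> hi"
    and step: "\<And>j s. lo \<le> j \<Longrightarrow> j < hi \<Longrightarrow> I j s \<Longrightarrow>
      tfits W b s \<and> tval b s \<and> wp W c (\<lambda>k s'. k \<le> kb \<and> I (Suc j) s') s"
    and exit: "\<And>s. I hi s \<Longrightarrow> tfits W b s \<and> \<not> tval b s"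
  shows "wp W (While b c) (\<lambda>k s'. k \<le> (hi - lo) * (kb + tcost b + 1) + tcost b + 1 \<and> I hi s') s"
  using \<open>lo \<le> hi\<close> init step
proof (induction lo arbitrary: s rule: inc_induct)
  case base
  then show ?case
    using exec.WhileFalse[of W b s c] exit[OF base(1)] unfolding wp_def by auto
next
  case (step j)
  obtain k1 s1 where 1: "exec W c s k1 s1" "k1 \<le> kb" "I (Suc j) s1"
    using step.prems(2)[OF _ _ step.prems(1)] step.hyps unfolding wp_def by blast
  have "wp W (While b c)
      (\<lambda>k s'. k \<le> (hi - Suc j) * (kb + tcost b + 1) + tcost b + 1 \<and> I hi s') s1"
    by (rule step.IH[OF 1(3)]) (use step.prems(2) Suc_leD in blast)
  then obtain k2 s2 where 2: "exec W (While b c) s1 k2 s2"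
      "k2 \<le> (hi - Suc j) * (kb + tcost b + 1) + tcost b + 1" "I hi s2"
    unfolding wp_def by blast
  have "exec W (While b c) s (tcost b + k1 + k2 + 1) s2"
    using step.prems(2)[OF _ _ step.prems(1)] step.hyps 1 2 by (intro exec.WhileTrue) auto
  moreover have "hi - j = Suc (hi - Suc j)"
    using step.hyps by simp
  ultimately show ?case
    using 1(2) 2 unfolding wp_def
    by (intro exI[of _ "tcost b + k1 + k2 + 1"] exI[of _ s2]) (auto simp: algebra_simps)
qed

lemma aval_fits: "afits W e s \<Longrightarrow> \<bar>aval e s\<bar> \<le> W"
  by (cases e) auto

section \<open>Program notation and loops that keep a running maximum\<close>

fun block :: "com list \<Rightarrow> com" where
  "block [] = Skip"
| "block (c # cs) = Seq c (block cs)"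

abbreviation Var :: "name \<Rightarrow> aexp" where
  "Var x \<equiv> Read x (Const 0)"

abbreviation Set :: "name \<Rightarrow> aexp \<Rightarrow> com" where
  "Set x \<equiv> Assign x (Const 0)"

abbreviation incr :: "name \<Rightarrow> aexp \<Rightarrow> com" where
  "incr x i \<equiv> Assign x i (Plus (Read x i) (Const 1))"

lemmas wp_simps = wp_Skip wp_Assign wp_Seq wp_If

definition raise :: "aexp \<Rightarrow> com" where
  "raise e = If (Less (Var ''out'') e) (Set ''out'' e) Skip"

definition raise_loop :: "name \<Rightarrow> aexp \<Rightarrow> aexp \<Rightarrow> com" where
  "raise_loop v b e = While (Less (Var v) b) (block [raise e, incr v (Const 0)])"

lemma wp_raise:
  assumes "afits W e s" "\<bar>s ''out'' 0\<bar> \<le> W"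
  shows "wp W (raise e) (\<lambda>k s'. k \<le> 2 * acost e + 6 \<and>
    s' = s(''out'' := (s ''out'')(0 := max (s ''out'' 0) (aval e s)))) s"
  using assms aval_fits[OF assms(1)] by (auto simp: raise_def wp_simps fun_eq_iff)

text \<open>The loop writes only the counter and \<open>''out''\<close>, so all its states have the
  form \<open>st j y\<close>. The expressions have to evaluate correctly for arbitrary
  \<open>y\<close>, which keeps the value of the running maximum out of the hypotheses.\<close>

lemma wp_raise_loop:
  fixes s v lo hi
  defines "st \<equiv> \<lambda>j y. s(v := (s v)(0 := int j), ''out'' := (s ''out'')(0 := y))"
  assumes v: "v \<noteq> ''out''" "s v 0 = int lo" and "lo \<le> hi"
    and W: "1 \<le> W" "int hi \<le> W" "\<bar>s ''out'' 0\<bar> \<le> W"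
    and b: "\<And>j y. afits W b (st j y) \<and> aval b (st j y) = int hi"
    and e: "\<And>j y. lo \<le> j \<Longrightarrow> j < hi \<Longrightarrow> afits W e (st j y) \<and> aval e (st j y) = f j"
  shows "wp W (raise_loop v b e) (\<lambda>k s'.
      k \<le> (hi - lo) * (2 * acost e + acost b + 20) + acost b + 4 \<and>
      s' = st hi (Max (insert (s ''out'' 0) (f ` {lo..<hi})))) s"
proof -
  let ?m = "\<lambda>j. Max (insert (s ''out'' 0) (f ` {lo..<j}))"
  let ?I = "\<lambda>j s'. s' = st j (?m j)"
  have st: "st j y ''out'' 0 = y" "st j y v 0 = int j" for j y
    using v(1) by (auto simp: st_def)
  have f: "\<bar>f j\<bar> \<le> W" if "lo \<le> j" "j < hi" for j
    using e[OF that] aval_fits by metis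
  \<comment> \<open>The running maximum is always the start value or some \<open>f j\<close>, and
    \<open>f j\<close> fits because \<open>e\<close> evaluates to it within the word size.\<close>
  have m: "\<bar>?m j\<bar> \<le> W" if "j \<le> hi" for j
  proof -
    have "?m j \<in> insert (s ''out'' 0) (f ` {lo..<j})"
      by (rule Max_in) auto
    then show ?thesis using f W that by auto
  qed
  have "wp W (raise_loop v b e) (\<lambda>k s'. k \<le> (hi - lo) * ((2 * acost e + 13) +
      tcost (Less (Var v) b) + 1) + tcost (Less (Var v) b) + 1 \<and> ?I hi s') s"
    unfolding raise_loop_def
  proof (rule wp_While)
    show "?I lo s"
      using v(2) by (auto simp: st_def fun_eq_iff)
    show "lo \<le> hi" by fact
    show "tfits W (Less (Var v) b) s' \<and> \<not> tval (Less (Var v) b) s'" if "?I hi s'" for s'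
      using that b st W by auto
  next
    fix j s' assume j: "lo \<le> j" "j < hi" and s': "?I j s'"
    have *: "afits W e s'" "aval e s' = f j" "\<bar>s' ''out'' 0\<bar> \<le> W" "s' v 0 = int j"
      "s' ''out'' 0 = ?m j"
      using e[OF j] m[of j] s' j st by auto
    have "{lo..<Suc j} = insert j {lo..<j}"
      using j by auto
    then have max: "max (?m j) (f j) = ?m (Suc j)"
      by (simp add: insert_commute max.commute)
    have "wp W (block [raise e, incr v (Const 0)])
        (\<lambda>k s'. k \<le> 2 * acost e + 13 \<and> ?I (Suc j) s') s'"
      unfolding block.simps wp_Seq
      apply (rule wp_mono[OF wp_raise[OF *(1,3)]])
      using v(1) j W *(4) max unfolding *(2,5)
      by (auto simp: wp_simps s' st_def fun_eq_iff)
    then show "tfits W (Less (Var v) b) s' \<and> tval (Less (Var v) b) s' \<and>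
        wp W (block [raise e, incr v (Const 0)])
          (\<lambda>k s'. k \<le> 2 * acost e + 13 \<and> ?I (Suc j) s') s'"
      using b s' st W j by auto
  qed
  then show ?thesis
    by (rule wp_mono) (auto simp: algebra_simps)
qed


section \<open>Delayed predictions\<close>

lemma count_list_take:
  "t \<le> length xs \<Longrightarrow> count_list (take t xs) x = card {u. u < t \<and> xs ! u = x}"
  by (auto simp: count_list_eq_length_filter length_filter_conv_card intro!: arg_cong[where f = card])

lemma delayed_length: "delayed d \<rho> \<rho>' \<Longrightarrow> length \<rho> = length \<rho>'"
  unfolding delayed_def by auto

lemma delayed_set: "delayed d \<rho> \<rho>' \<Longrightarrow> set \<rho> = set \<rho>'"
  unfolding delayed_def close_to_id_def by (metis set_permute_list)

text \<open>The permutation sends a predicted position to an actual one at distance at most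
  \<open>d\<close>. Occurrences of \<open>x\<close> below \<open>t - d\<close> in the prediction
  thus inject into those below \<open>t\<close> in reality; conversely an actual position below
  \<open>t\<close> comes from a predicted one below \<open>t + d\<close>, and without
  \<open>x\<close> in the window it lies below \<open>t - d\<close>. Truncated subtraction covers
  \<open>t < d\<close>.\<close>

lemma delayed_counts:
  assumes "delayed d \<rho> \<rho>'" and t: "t \<le> length \<rho>"
  shows "count_list (take (t - d) \<rho>') x \<le> count_list (take t \<rho>) x"
    and "(\<And>q. t - d \<le> q \<Longrightarrow> q < length \<rho>' \<Longrightarrow> q < t + d \<Longrightarrow> \<rho>' ! q \<noteq> x) \<Longrightarrow>
      count_list (take t \<rho>) x = count_list (take (t - d) \<rho>') x"
proof -
  obtain \<pi> where \<pi>: "\<pi> permutes {..<length \<rho>}" "permute_list \<pi> \<rho> = \<rho>'"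
    and close: "\<And>u. u < length \<rho> \<Longrightarrow> \<bar>int (inv \<pi> u) - int u\<bar> \<le> int d"
    using assms unfolding delayed_def close_to_id_def by auto
  have len: "length \<rho>' = length \<rho>"
    using \<pi> by auto
  have nth: "\<rho>' ! q = \<rho> ! \<pi> q" if "q < length \<rho>" for q
    using permute_list_nth[OF \<pi>(1) that] \<pi>(2) by simp
  have lt: "\<pi> q < length \<rho>" if "q < length \<rho>" for q
    using permutes_in_image[OF \<pi>(1), of q] that by simp
  have inv: "inv \<pi> (\<pi> q) = q" "\<pi> (inv \<pi> q) = q" for q
    using permutes_inverses[OF \<pi>(1)] by auto
  have inj: "inj_on \<pi> X" for X
    using inv by (metis inj_onI)
  let ?A = "{u. u < t \<and> \<rho> ! u = x}" and ?B = "{q. q < t - d \<and> \<rho>' ! q = x}"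
  have card: "count_list (take t \<rho>) x = card ?A" "count_list (take (t - d) \<rho>') x = card ?B"
    using t len by (auto intro!: count_list_take)
  have sub: "\<pi> ` ?B \<subseteq> ?A"
  proof safe
    fix q assume q: "q < t - d" "x = \<rho>' ! q"
    then show "\<pi> q < t"
      using close[OF lt, of q] inv(1)[of q] t by linarith
    show "\<rho> ! \<pi> q = \<rho>' ! q"
      using nth[of q] q t by simp
  qed
  then have "card (\<pi> ` ?B) \<le> card ?A"
    by (intro card_mono) auto
  then show "count_list (take (t - d) \<rho>') x \<le> count_list (take t \<rho>) x"
    by (simp add: card card_image[OF inj])
  assume none: "\<And>q. t - d \<le> q \<Longrightarrow> q < length \<rho>' \<Longrightarrow> q < t + d \<Longrightarrow> \<rho>' ! q \<noteq> x"
  have "?A \<subseteq> \<pi> ` ?B"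
  proof
    fix u assume u: "u \<in> ?A"
    have lt': "inv \<pi> u < length \<rho>"
      using permutes_in_image[OF permutes_inv[OF \<pi>(1)], of u] u t by simp
    then have "\<rho>' ! inv \<pi> u = x"
      using nth[of "inv \<pi> u"] inv u by simp
    moreover have "inv \<pi> u < t + d"
      using close[of u] u t by auto
    ultimately have "inv \<pi> u \<in> ?B"
      using none[of "inv \<pi> u"] lt' len by force
    then show "u \<in> \<pi> ` ?B"
      using inv(2)[of u] by (metis imageI)
  qed
  with sub have "?A = \<pi> ` ?B" by blast
  then show "count_list (take t \<rho>) x = count_list (take (t - d) \<rho>') x"
    by (simp add: card card_image[OF inj])
qed

section \<open>Matrices after a sequence of requests\<close>

definition row_count :: "request list \<Rightarrow> nat \<Rightarrow> int" where
  "row_count xs i = int (count_list xs (IncRow i))"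

definition col_count :: "request list \<Rightarrow> nat \<Rightarrow> int" where
  "col_count xs j = int (count_list xs (IncCol j))"

definition matrix_after :: "matrix \<Rightarrow> request list \<Rightarrow> matrix" where
  "matrix_after M xs = (\<lambda>i j. M i j + row_count xs i + col_count xs j)"

lemma apply_request_matrix_after:
  "apply_request r (matrix_after M xs) = matrix_after M (xs @ [r])"
  by (cases r) (auto simp: matrix_after_def row_count_def col_count_def fun_eq_iff)

lemma finite_entries: "finite {M i j | i j. i < (n::nat) \<and> j < (n::nat)}"
proof -
  have "{M i j | i j. i < n \<and> j < n} = (\<lambda>(i, j). M i j) ` ({..<n} \<times> {..<n})"
    by auto
  then show ?thesis by simp
qed

lemma entry_le_max_entry: "i < n \<Longrightarrow> j < n \<Longrightarrow> M i j \<le> max_entry n M"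
  unfolding max_entry_def by (rule Max_ge[OF finite_entries]) auto

lemma max_entry_attained: "1 \<le> n \<Longrightarrow> \<exists>i<n. \<exists>j<n. max_entry n M = M i j"
  using Max_in[OF finite_entries[of M n]] unfolding max_entry_def by force

lemma max_entry_eqI:
  assumes "1 \<le> n" "\<And>i j. i < n \<Longrightarrow> j < n \<Longrightarrow> M i j \<le> v" "v \<le> max_entry n M"
  shows "v = max_entry n M"
  using assms max_entry_attained[of n M] by force

text \<open>Replaces the recursion of \<open>serves\<close> over the remaining requests by an
  invariant indexed by the time \<open>t\<close>, with the matrix recovered from the processed
  prefix. The invariant may mention the whole of \<open>\<rho>\<close>; only the handlers are
  confined to memory and the current request. The induction runs from the end of the sequence back
  to \<open>0\<close>.\<close>

lemma serves_invariant:
  assumes init: "Inv 0 s"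
    and qry: "\<And>t s. t < length \<rho> \<Longrightarrow> Inv t s \<Longrightarrow> \<rho> ! t = Query \<Longrightarrow>
      wp W qry (\<lambda>k s'. real k \<le> q \<and> s' ''out'' 0 = max_entry n (matrix_after M (take t \<rho>)) \<and>
        Inv (Suc t) s') (receive Query s)"
    and upd: "\<And>t s. t < length \<rho> \<Longrightarrow> Inv t s \<Longrightarrow> \<rho> ! t \<noteq> Query \<Longrightarrow>
      wp W upd (\<lambda>k s'. real k \<le> u \<and> Inv (Suc t) s') (receive (\<rho> ! t) s)"
  shows "serves W upd qry u q n M s \<rho>"
proof -
  have "serves W upd qry u q n (matrix_after M (take t \<rho>)) s (drop t \<rho>)"
    if "t \<le> length \<rho>" "Inv t s" for t s
    using that
  proof (induction t arbitrary: s rule: inc_induct)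
    case base
    then show ?case by simp
  next
    case (step t)
    have drop: "drop t \<rho> = \<rho> ! t # drop (Suc t) \<rho>"
      using step.hyps by (simp add: Cons_nth_drop_Suc)
    have after: "apply_request (\<rho> ! t) (matrix_after M (take t \<rho>)) = matrix_after M (take (Suc t) \<rho>)"
      using step.hyps by (simp add: apply_request_matrix_after take_Suc_conv_app_nth)
    have upd': "\<exists>k s'. exec W upd (receive (\<rho> ! t) s) k s' \<and> real k \<le> u \<and>
        serves W upd qry u q n (apply_request (\<rho> ! t) (matrix_after M (take t \<rho>))) s'
          (drop (Suc t) \<rho>)" if "\<rho> ! t \<noteq> Query"
      using upd[OF step.hyps(2) step.prems that] step.IH unfolding wp_def after by blast
    show ?case
    proof (cases "\<rho> ! t")
      case (IncRow i)
      with upd' show ?thesis unfolding drop by simp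
    next
      case (IncCol i)
      with upd' show ?thesis unfolding drop by simp
    next
      case Query
      then have "matrix_after M (take (Suc t) \<rho>) = matrix_after M (take t \<rho>)"
        using after by simp
      with qry[OF step.hyps(2) step.prems Query] step.IH show ?thesis
        unfolding wp_def drop Query serves.simps by metis
    qed
  qed
  from this[of 0 s] init show ?thesis
    by (simp add: matrix_after_def row_count_def col_count_def)
qed

section \<open>The programs\<close>

text \<open>Row-major addressing of width \<open>n\<close>, shared by the matrix and the tables; in
  a table the prefix length takes the place of the row.\<close>

definition cell :: "name \<Rightarrow> aexp \<Rightarrow> aexp \<Rightarrow> aexp" where
  "cell x i j = Read x (Plus (Times i (Var ''n'')) j)"

text \<open>Starting from the value of \<open>e\<close> at index \<open>0\<close> avoids a
  substitute for minus infinity, as entries may be negative. The loop meets index \<open>0\<close> a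
  second time, harmlessly.\<close>

definition fill :: "name \<Rightarrow> aexp \<Rightarrow> name \<Rightarrow> aexp \<Rightarrow> com" where
  "fill x a v e = block [Set v (Const 0), Set ''out'' e, raise_loop v (Var ''n'') e,
     Assign x a (Var ''out'')]"

text \<open>The count of the row itself is deliberately left out: the handlers add its current
  value, which is exact. The column table is built in the same way.\<close>

definition fill_row_maxima :: com where
  "fill_row_maxima = fill ''rowmax'' (Plus (Times (Var ''p'') (Var ''n'')) (Var ''i'')) ''j''
     (Plus (cell ''matrix'' (Var ''i'') (Var ''j'')) (Read ''lcol'' (Var ''j'')))"

definition fill_col_maxima :: com where
  "fill_col_maxima = fill ''colmax'' (Plus (Times (Var ''p'') (Var ''n'')) (Var ''i'')) ''j''
     (Plus (cell ''matrix'' (Var ''j'') (Var ''i'')) (Read ''lrow'' (Var ''j'')))"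

definition fill_maxima :: com where
  "fill_maxima = While (Less (Var ''i'') (Var ''n''))
     (block [fill_row_maxima, fill_col_maxima, incr ''i'' (Const 0)])"

definition fill_top :: com where
  "fill_top = fill ''top'' (Var ''p'') ''i''
     (Plus (cell ''rowmax'' (Var ''p'') (Var ''i'')) (Read ''lrow'' (Var ''i'')))"

text \<open>Runs after the tables for prefix length \<open>p\<close> are filled, so the counts used
  there are those of the first \<open>p\<close> predictions. In the last pass \<open>p\<close> is
  the length of the prediction; the cell read then holds \<open>0\<close>, the kind of a query, and
  nothing is counted.\<close>

definition count_prediction :: com where
  "count_prediction =
     If (Equal (Read ''pred_kind'' (Var ''p'')) (Const 1))
       (incr ''lrow'' (Read ''pred_index'' (Var ''p'')))
       (If (Equal (Read ''pred_kind'' (Var ''p'')) (Const 2))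
         (incr ''lcol'' (Read ''pred_index'' (Var ''p''))) Skip)"

definition preprocess :: com where
  "preprocess = block [
     While (Less (Var ''p'') (Plus (Var ''T'') (Const 1)))
       (block [Set ''i'' (Const 0), fill_maxima, fill_top, count_prediction, incr ''p'' (Const 0)]),
     Set ''out'' (Read ''top'' (Const 0))]"

definition tick :: com where
  "tick = incr ''t'' (Const 0)"

definition count_request :: com where
  "count_request = block [
     If (Equal (Var ''kind'') (Const 1))
       (incr ''rowcnt'' (Var ''index'')) (incr ''colcnt'' (Var ''index'')),
     tick]"

text \<open>When this runs, \<open>''t''\<close> already includes the current request. For a query
  this is harmless, because a query does not change the matrix.\<close>

definition set_window :: com where
  "set_window = block [
     Set ''lo'' (Minus (Var ''t'') (Var ''d'')),
     If (Less (Var ''lo'') (Const 0)) (Set ''lo'' (Const 0)) Skip,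
     Set ''hi'' (Plus (Var ''t'') (Var ''d'')),
     If (Less (Var ''T'') (Var ''hi'')) (Set ''hi'' (Var ''T'')) Skip,
     Set ''q'' (Var ''lo'')]"

definition current :: "aexp \<Rightarrow> aexp \<Rightarrow> aexp" where
  "current i j = Plus (Plus (cell ''matrix'' i j) (Read ''rowcnt'' i)) (Read ''colcnt'' j)"

definition row_bound :: "aexp \<Rightarrow> aexp" where
  "row_bound i = Plus (cell ''rowmax'' (Var ''lo'') i) (Read ''rowcnt'' i)"

definition col_bound :: "aexp \<Rightarrow> aexp" where
  "col_bound j = Plus (cell ''colmax'' (Var ''lo'') j) (Read ''colcnt'' j)"

text \<open>
  The handlers never check whether a predicted request in the window is a row or a column increment:
  its index is in any case that of an actual row and column (\<open>0\<close> for a query), so every value they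
  look at is at most the true maximum.
\<close>

definition update_maximum :: com where
  "update_maximum = block [
     count_request, set_window,
     If (Equal (Var ''kind'') (Const 1))
       (block [raise (row_bound (Var ''index'')),
          raise_loop ''q'' (Var ''hi'') (current (Var ''index'') (Read ''pred_index'' (Var ''q'')))])
       (block [raise (col_bound (Var ''index'')),
          raise_loop ''q'' (Var ''hi'') (current (Read ''pred_index'' (Var ''q'')) (Var ''index''))])]"

definition query_window :: com where
  "query_window = block [
     tick, set_window, Set ''out'' (Read ''top'' (Var ''lo'')),
     While (Less (Var ''q'') (Var ''hi''))
       (block [raise (row_bound (Read ''pred_index'' (Var ''q''))),
          raise (col_bound (Read ''pred_index'' (Var ''q''))),
          Set ''r'' (Var ''lo''),
          raise_loop ''r'' (Var ''hi'')
            (current (Read ''pred_index'' (Var ''q'')) (Read ''pred_index'' (Var ''r''))),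
          incr ''q'' (Const 0)])]"

section \<open>Verification of the preprocessing\<close>

lemma wp_fill:
  fixes s v
  defines "st \<equiv> \<lambda>j y. s(v := (s v)(0 := int j), ''out'' := (s ''out'')(0 := y))"
  assumes v: "v \<noteq> ''out''" "v \<noteq> ''n''" and x: "x \<noteq> ''out''" "x \<noteq> v"
    and n: "s ''n'' 0 = int n" "1 \<le> n" "int n \<le> W"
    and e: "\<And>j y. j < n \<Longrightarrow> afits W e (st j y) \<and> aval e (st j y) = f j"
    and a: "\<And>y. afits W a (st n y) \<and> aval a (st n y) = a'"
  shows "wp W (fill x a v e) (\<lambda>k s'. k \<le> n * (2 * acost e + 22) + acost e + acost a + 20 \<and>
    s' = (st n (Max (f ` {0..<n})))(x := (s x)(a' := Max (f ` {0..<n})))) s"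
proof -
  let ?m = "Max (f ` {0..<n})"
  define s0 where "s0 = st 0 (f 0)"
  have st0: "s(v := (s v)(0 := 0)) = st 0 (s ''out'' 0)"
    using v by (auto simp: st_def fun_eq_iff)
  have s0: "(st 0 y)(''out'' := (st 0 y ''out'')(0 := f 0)) = s0" for y
    by (auto simp: st_def s0_def fun_eq_iff)
  have st_s0: "s0(v := (s0 v)(0 := int j), ''out'' := (s0 ''out'')(0 := y)) = st j y" for j y
    using v by (auto simp: st_def s0_def fun_eq_iff)
  \<comment> \<open>The start value is itself one of the compared values, so it disappears from the
    maximum; this is where \<open>1 \<le> n\<close> enters.\<close>
  have insert: "insert (f 0) (f ` {0..<n}) = f ` {0..<n}"
    using n by (intro insert_absorb) auto
  have f0: "\<bar>f 0\<bar> \<le> W"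
    using e[of 0] n aval_fits by fastforce
  have m: "\<bar>?m\<bar> \<le> W"
  proof -
    have "?m \<in> f ` {0..<n}"
      by (rule Max_in) (use n in auto)
    then show ?thesis using e aval_fits by fastforce
  qed
  have loop: "wp W (raise_loop v (Var ''n'') e) (\<lambda>k s'. k \<le> (n - 0) *
      (2 * acost e + acost (Var ''n'') + 20) + acost (Var ''n'') + 4 \<and>
      s' = s0(v := (s0 v)(0 := int n), ''out'' := (s0 ''out'')(0 :=
        Max (insert (s0 ''out'' 0) (f ` {0..<n}))))) s0"
    by (rule wp_raise_loop, unfold st_s0)
      (use v n e f0 in \<open>auto simp: s0_def st_def\<close>)
  have "s0 ''out'' 0 = f 0"
    by (simp add: s0_def st_def)
  note loop = loop[unfolded st_s0 this insert]
  have st: "st n ?m x = s x" "st n ?m ''out'' 0 = ?m"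
    using x by (simp_all add: st_def)
  have 1: "1 \<le> W" using n by simp
  show ?thesis
    unfolding fill_def block.simps wp_Seq wp_Assign
    using 1 n e[of 0 "s ''out'' 0"] f0
    apply (simp add: st0 s0)
    apply (rule wp_mono[OF loop])
    using a[of ?m] m x by (auto simp: wp_simps st algebra_simps)
qed

text \<open>Uniqueness of division with remainder. It guarantees that writing one table cell leaves
  the other cells of the table intact.\<close>

lemma cell_address_eq_iff:
  assumes "i < n" "j < n"
  shows "int p * int n + int i = int q * int n + int j \<longleftrightarrow> p = q \<and> i = j"
proof
  assume "int p * int n + int i = int q * int n + int j"
  then have "p * n + i = q * n + j"
    by (metis of_nat_add of_nat_eq_iff of_nat_mult)
  moreover have "(p * n + i) div n = p" "(p * n + i) mod n = i"
      "(q * n + j) div n = q" "(q * n + j) mod n = j"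
    using assms by auto
  ultimately show "p = q \<and> i = j" by metis
qed auto

lemma acost_bounds [simp]:
  "acost (current a b) = 2 * acost a + 2 * acost b + 9"
  "acost (row_bound a) = 2 * acost a + 9"
  "acost (col_bound a) = 2 * acost a + 9"
  by (simp_all add: current_def row_bound_def col_bound_def cell_def)

text \<open>Origin of the bound on \<open>W\<close>: \<open>B\<close> and twice the length for an
  entry plus its row and column counts, \<open>d\<close> for \<open>t + d\<close>, \<open>2\<close>
  for the small constants, and the two products for the addresses in the matrix and in the
  tables.\<close>

locale erickson =
  fixes n d B :: nat and M :: matrix and \<rho>' :: "request list" and W :: int
  assumes n: "1 \<le> n"
    and entries: "\<And>i j. i < n \<Longrightarrow> j < n \<Longrightarrow> \<bar>M i j\<bar> \<le> int B"
    and valid: "\<And>r. r \<in> set \<rho>' \<Longrightarrow> valid_request n r"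
    and W: "int (B + d + 2 * length \<rho>' + 2 + n * n + (length \<rho>' + 1) * n) \<le> W"
begin

abbreviation T :: nat where
  "T \<equiv> length \<rho>'"

abbreviation lrow :: "nat \<Rightarrow> nat \<Rightarrow> int" where
  "lrow p \<equiv> row_count (take p \<rho>')"

abbreviation lcol :: "nat \<Rightarrow> nat \<Rightarrow> int" where
  "lcol p \<equiv> col_count (take p \<rho>')"

definition row_max :: "nat \<Rightarrow> nat \<Rightarrow> int" where
  "row_max p i = Max ((\<lambda>j. M i j + lcol p j) ` {0..<n})"

definition col_max :: "nat \<Rightarrow> nat \<Rightarrow> int" where
  "col_max p j = Max ((\<lambda>i. M i j + lrow p i) ` {0..<n})"

definition top_max :: "nat \<Rightarrow> int" where
  "top_max p = Max ((\<lambda>i. row_max p i + lrow p i) ` {0..<n})"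

definition idx :: "nat \<Rightarrow> nat" where
  "idx q = nat (request_index (\<rho>' ! q))"

lemma idx: "q < T \<Longrightarrow> idx q < n" "int (idx q) = request_index (\<rho>' ! q)"
proof -
  show "int (idx q) = request_index (\<rho>' ! q)"
    by (cases "\<rho>' ! q") (simp_all add: idx_def)
  show "idx q < n" if "q < T"
    using valid[OF nth_mem[OF that]] n by (cases "\<rho>' ! q") (simp_all add: idx_def)
qed

lemma count_bounds:
  "length xs \<le> T \<Longrightarrow> 0 \<le> row_count xs i \<and> row_count xs i \<le> int T"
  "length xs \<le> T \<Longrightarrow> 0 \<le> col_count xs i \<and> col_count xs i \<le> int T"
  using count_le_length[of xs "IncRow i"] count_le_length[of xs "IncCol i"]
  unfolding row_count_def col_count_def by simp_all

lemma row_max_in: "\<exists>j<n. row_max p i = M i j + lcol p j"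
  using Max_in[of "(\<lambda>j. M i j + lcol p j) ` {0..<n}"] n unfolding row_max_def by fastforce

lemma row_max_ge: "j < n \<Longrightarrow> M i j + lcol p j \<le> row_max p i"
  unfolding row_max_def by (rule Max_ge) auto

lemma col_max_in: "\<exists>i<n. col_max p j = M i j + lrow p i"
  using Max_in[of "(\<lambda>i. M i j + lrow p i) ` {0..<n}"] n unfolding col_max_def by fastforce

lemma col_max_ge: "i < n \<Longrightarrow> M i j + lrow p i \<le> col_max p j"
  unfolding col_max_def by (rule Max_ge) auto

lemma top_max_in: "\<exists>i<n. \<exists>j<n. top_max p = M i j + lrow p i + lcol p j"
proof -
  have "top_max p \<in> (\<lambda>i. row_max p i + lrow p i) ` {0..<n}"
    unfolding top_max_def by (rule Max_in) (use n in auto)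
  then obtain i where "i < n" "top_max p = row_max p i + lrow p i" by auto
  moreover obtain j where "j < n" "row_max p i = M i j + lcol p j"
    using row_max_in by blast
  ultimately show ?thesis
    by (intro exI[of _ i] exI[of _ j] conjI) simp_all
qed

lemma top_max_ge:
  assumes "i < n" "j < n"
  shows "M i j + lrow p i + lcol p j \<le> top_max p"
proof -
  have "row_max p i + lrow p i \<le> top_max p"
    unfolding top_max_def by (rule Max_ge) (use assms in auto)
  with row_max_ge[OF assms(2), of i p] show ?thesis by simp
qed

lemma max_bounds:
  "i < n \<Longrightarrow> \<bar>row_max p i\<bar> \<le> int B + int T"
  "i < n \<Longrightarrow> \<bar>col_max p i\<bar> \<le> int B + int T"
  "\<bar>top_max p\<bar> \<le> int B + 2 * int T"
proof -
  have l: "0 \<le> lrow p i \<and> lrow p i \<le> int T" "0 \<le> lcol p i \<and> lcol p i \<le> int T" for i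
    using count_bounds[of "take p \<rho>'" i] by simp_all
  show "\<bar>row_max p i\<bar> \<le> int B + int T" if "i < n"
    using row_max_in[of p i] entries[OF that] l by (smt (verit))
  show "\<bar>col_max p i\<bar> \<le> int B + int T" if "i < n"
    using col_max_in[of p i] entries[OF _ that] l by (smt (verit))
  show "\<bar>top_max p\<bar> \<le> int B + 2 * int T"
    using top_max_in[of p] entries l by (smt (verit))
qed

lemma W_ge: "int B + int d + 2 * int T + 2 \<le> W" "int n \<le> W"
proof -
  have "int (B + d + 2 * T + 2) \<le> W" "int n \<le> W"
    using W by (rule order_trans[rotated], unfold of_nat_le_iff, simp)+
  then show "int B + int d + 2 * int T + 2 \<le> W" "int n \<le> W"
    by simp_all
qed

text \<open>The first alternative for \<open>p\<close> is meant for the tables, whose rows are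
  prefix lengths, the second for the matrix. Either way the address is below
  \<open>(p + 1) * n\<close>.\<close>

lemma address_fits:
  assumes "p \<le> T \<or> p < n" "i < n"
  shows "int p * int n + int i \<le> W" "int p * int n \<le> W" "int p \<le> W"
proof -
  have "p * n + i \<le> n * n + (T + 1) * n"
  proof -
    consider "p \<le> T" | "Suc p \<le> n" using assms by linarith
    then have "Suc p * n \<le> n * n + (T + 1) * n"
    proof cases
      case 1
      then have "Suc p * n \<le> (T + 1) * n" by (intro mult_right_mono) auto
      then show ?thesis by linarith
    next
      case 2
      then have "Suc p * n \<le> n * n" by (intro mult_right_mono) auto
      then show ?thesis by linarith
    qed
    with assms show ?thesis by simp
  qed
  then have "int (p * n + i) \<le> W"
    using W by linarith
  then show "int p * int n + int i \<le> W" by simp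
  then show *: "int p * int n \<le> W" by simp
  have "int p \<le> int p * int n"
    using n by (simp add: mult_le_cancel_left1)
  with * show "int p \<le> W" by simp
qed

definition static :: "state \<Rightarrow> bool" where
  "static s \<longleftrightarrow> s ''n'' 0 = int n \<and> s ''d'' 0 = int d \<and> s ''T'' 0 = int T \<and>
     (\<forall>i<n. \<forall>j<n. s ''matrix'' (int i * int n + int j) = M i j) \<and>
     (\<forall>q<T. s ''pred_index'' (int q) = int (idx q))"

text \<open>The tables are complete for the predicted prefixes shorter than \<open>p\<close>, and for the prefix of
  length \<open>p\<close> the maxima of the rows and columns below \<open>i\<close> are.\<close>

definition tables :: "nat \<Rightarrow> nat \<Rightarrow> state \<Rightarrow> bool" where
  "tables p i s \<longleftrightarrow> (\<forall>p' i'. i' < n \<and> (p' < p \<or> p' = p \<and> i' < i) \<longrightarrow>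
       s ''rowmax'' (int p' * int n + int i') = row_max p' i' \<and>
       s ''colmax'' (int p' * int n + int i') = col_max p' i') \<and>
     (\<forall>p'<p. s ''top'' (int p') = top_max p')"

text \<open>The kinds are described beyond the end of the prediction as well, since the last pass
  reads the cell there. The three zero arrays are the counters from which the handlers
  start.\<close>

definition predicting :: "nat \<Rightarrow> state \<Rightarrow> bool" where
  "predicting p s \<longleftrightarrow> static s \<and> s ''p'' 0 = int p \<and>
     (\<forall>q. s ''pred_kind'' (int q) = (if q < T then request_kind (\<rho>' ! q) else 0)) \<and>
     (\<forall>i<n. s ''lrow'' (int i) = lrow p i \<and> s ''lcol'' (int i) = lcol p i) \<and>
     s ''rowcnt'' = (\<lambda>_. 0) \<and> s ''colcnt'' = (\<lambda>_. 0) \<and> s ''t'' = (\<lambda>_. 0)"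

text \<open>A frame rule, as are the next two lemmas: as simplification rules they discard writes to
  unrelated arrays, the array names being compared as strings.\<close>

lemma static_upd [simp]:
  "x \<notin> {''n'', ''d'', ''T'', ''matrix'', ''pred_index''} \<Longrightarrow> static (s(x := f)) \<longleftrightarrow> static s"
proof -
  assume "x \<notin> {''n'', ''d'', ''T'', ''matrix'', ''pred_index''}"
  then have "(s(x := f)) y = s y" if "y \<in> {''n'', ''d'', ''T'', ''matrix'', ''pred_index''}" for y
    using that by (metis fun_upd_other)
  then show ?thesis by (simp add: static_def del: fun_upd_apply)
qed

lemma tables_upd [simp]:
  "x \<notin> {''rowmax'', ''colmax'', ''top''} \<Longrightarrow> tables p i (s(x := f)) \<longleftrightarrow> tables p i s"
proof -
  assume "x \<notin> {''rowmax'', ''colmax'', ''top''}"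
  then have "(s(x := f)) y = s y" if "y \<in> {''rowmax'', ''colmax'', ''top''}" for y
    using that by (metis fun_upd_other)
  then show ?thesis by (simp add: tables_def del: fun_upd_apply)
qed

lemma predicting_upd [simp]:
  "x \<notin> {''n'', ''d'', ''T'', ''matrix'', ''pred_index'', ''p'', ''pred_kind'', ''lrow'', ''lcol'',
     ''rowcnt'', ''colcnt'', ''t''} \<Longrightarrow> predicting p (s(x := f)) \<longleftrightarrow> predicting p s"
proof -
  assume "x \<notin> {''n'', ''d'', ''T'', ''matrix'', ''pred_index'', ''p'', ''pred_kind'', ''lrow'', ''lcol'',
     ''rowcnt'', ''colcnt'', ''t''}"
  then have "(s(x := f)) y = s y" if "y \<in> {''n'', ''d'', ''T'', ''matrix'', ''pred_index'', ''p'', ''pred_kind'', ''lrow'', ''lcol'',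
     ''rowcnt'', ''colcnt'', ''t''}" for y
    using that by (metis fun_upd_other)
  then show ?thesis by (simp add: predicting_def static_def del: fun_upd_apply)
qed

text \<open>The scratch arrays keep unspecified contents \<open>f\<close> and \<open>g\<close>. The
  value expression costs \<open>13\<close> and the address \<open>8\<close>, which gives
  \<open>48 = 2 * 13 + 22\<close> and \<open>41 = 13 + 8 + 20\<close>.\<close>

lemma wp_fill_row_maxima:
  assumes "predicting p s" "s ''i'' 0 = int i" "p \<le> T" "i < n"
  shows "wp W fill_row_maxima (\<lambda>k s'. k \<le> 48 * n + 41 \<and>
    (\<exists>f g. s' = s(''j'' := f, ''out'' := g,
      ''rowmax'' := (s ''rowmax'')(int p * int n + int i := row_max p i)))) s"
proof -
  have l: "0 \<le> lcol p j \<and> lcol p j \<le> int T" for j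
    using count_bounds[of "take p \<rho>'" j] by simp_all
  let ?st = "\<lambda>j y. s(''j'' := (s ''j'')(0 := int j), ''out'' := (s ''out'')(0 := y))"
  let ?e = "Plus (cell ''matrix'' (Var ''i'') (Var ''j'')) (Read ''lcol'' (Var ''j''))"
  let ?a = "Plus (Times (Var ''p'') (Var ''n'')) (Var ''i'')"
  have "wp W fill_row_maxima (\<lambda>k s'. k \<le> n * (2 * acost ?e + 22) + acost ?e + acost ?a + 20 \<and>
    s' = (?st n (row_max p i))(''rowmax'' :=
      (s ''rowmax'')(int p * int n + int i := row_max p i))) s"
    unfolding fill_row_maxima_def row_max_def
  proof (rule wp_fill)
    fix j y assume j: "j < n"
    show "afits W ?e (?st j y) \<and> aval ?e (?st j y) = M i j + lcol p j"
      using assms(1,2) j \<open>i < n\<close> W_ge l[of j] entries[OF \<open>i < n\<close> j] address_fits[of i j] address_fits[of j j]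
      by (auto simp: cell_def predicting_def static_def abs_le_iff)
  next
    fix y
    show "afits W ?a (?st n y) \<and> aval ?a (?st n y) = int p * int n + int i"
      using assms W_ge address_fits[of p i] address_fits[of i i]
      by (auto simp: predicting_def static_def)
  qed (use assms n W_ge in \<open>auto simp: predicting_def static_def\<close>)
  then show ?thesis
    by (rule wp_mono) (auto simp: cell_def)
qed

lemma wp_fill_col_maxima:
  assumes "predicting p s" "s ''i'' 0 = int i" "p \<le> T" "i < n"
  shows "wp W fill_col_maxima (\<lambda>k s'. k \<le> 48 * n + 41 \<and>
    (\<exists>f g. s' = s(''j'' := f, ''out'' := g,
      ''colmax'' := (s ''colmax'')(int p * int n + int i := col_max p i)))) s"
proof -
  have l: "0 \<le> lrow p j \<and> lrow p j \<le> int T" for j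
    using count_bounds[of "take p \<rho>'" j] by simp_all
  let ?st = "\<lambda>j y. s(''j'' := (s ''j'')(0 := int j), ''out'' := (s ''out'')(0 := y))"
  let ?e = "Plus (cell ''matrix'' (Var ''j'') (Var ''i'')) (Read ''lrow'' (Var ''j''))"
  let ?a = "Plus (Times (Var ''p'') (Var ''n'')) (Var ''i'')"
  have "wp W fill_col_maxima (\<lambda>k s'. k \<le> n * (2 * acost ?e + 22) + acost ?e + acost ?a + 20 \<and>
    s' = (?st n (col_max p i))(''colmax'' :=
      (s ''colmax'')(int p * int n + int i := col_max p i))) s"
    unfolding fill_col_maxima_def col_max_def
  proof (rule wp_fill)
    fix j y assume j: "j < n"
    show "afits W ?e (?st j y) \<and> aval ?e (?st j y) = M j i + lrow p j"
      using assms(1,2) j \<open>i < n\<close> W_ge l[of j] entries[OF j \<open>i < n\<close>] address_fits[of j i]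
        address_fits[of i i]
      by (auto simp: cell_def predicting_def static_def abs_le_iff)
  next
    fix y
    show "afits W ?a (?st n y) \<and> aval ?a (?st n y) = int p * int n + int i"
      using assms W_ge address_fits[of p i] address_fits[of i i]
      by (auto simp: predicting_def static_def)
  qed (use assms n W_ge in \<open>auto simp: predicting_def static_def\<close>)
  then show ?thesis
    by (rule wp_mono) (auto simp: cell_def)
qed

lemma tables_Suc:
  assumes "tables p i s" "i < n"
    "s' ''rowmax'' = (s ''rowmax'')(int p * int n + int i := row_max p i)"
    "s' ''colmax'' = (s ''colmax'')(int p * int n + int i := col_max p i)"
    "s' ''top'' = s ''top''"
  shows "tables p (Suc i) s'"
  using assms cell_address_eq_iff[of _ n i] unfolding tables_def by (auto simp: less_Suc_eq)


lemma wp_fill_maxima: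
  assumes "predicting p s" "tables p 0 s" "s ''i'' 0 = 0" "p \<le> T"
  shows "wp W fill_maxima (\<lambda>k s'. k \<le> n * (96 * n + 100) + 6 \<and> predicting p s' \<and> tables p n s') s"
proof -
  let ?I = "\<lambda>i s. predicting p s \<and> tables p i s \<and> s ''i'' 0 = int i"
  have "wp W fill_maxima (\<lambda>k s'. k \<le> (n - 0) * ((96 * n + 90) +
      tcost (Less (Var ''i'') (Var ''n'')) + 1) + tcost (Less (Var ''i'') (Var ''n'')) + 1 \<and>
      ?I n s') s"
    unfolding fill_maxima_def
  proof (rule wp_While[where I = ?I and lo = 0])
    show "?I 0 s" using assms by simp
    show "tfits W (Less (Var ''i'') (Var ''n'')) s \<and> \<not> tval (Less (Var ''i'') (Var ''n'')) s"
      if "?I n s" for s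
      using that W_ge by (auto simp: predicting_def static_def)
  next
    fix i s assume i: "i < n" and I: "?I i s"
    have "wp W (block [fill_row_maxima, fill_col_maxima, incr ''i'' (Const 0)])
        (\<lambda>k s'. k \<le> 96 * n + 90 \<and> ?I (Suc i) s') s"
      unfolding block.simps wp_Seq
    proof (rule wp_mono[OF wp_fill_row_maxima[of p s i]])
      fix k1 s1
      assume 1: "k1 \<le> 48 * n + 41 \<and> (\<exists>f g. s1 = s(''j'' := f, ''out'' := g,
        ''rowmax'' := (s ''rowmax'')(int p * int n + int i := row_max p i)))"
      then have "predicting p s1" "s1 ''i'' 0 = int i"
        using I by auto
      then show "wp W fill_col_maxima (\<lambda>k2. wp W (incr ''i'' (Const 0)) (\<lambda>k3. wp W Skip
          (\<lambda>k4 s'. k1 + (k2 + (k3 + k4)) \<le> 96 * n + 90 \<and> ?I (Suc i) s'))) s1"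
      proof (rule wp_mono[OF wp_fill_col_maxima])
        fix k2 s2
        assume 2: "k2 \<le> 48 * n + 41 \<and> (\<exists>f g. s2 = s1(''j'' := f, ''out'' := g,
          ''colmax'' := (s1 ''colmax'')(int p * int n + int i := col_max p i)))"
        have "predicting p s2" "s2 ''i'' 0 = int i"
          using I 1 2 by auto
        moreover have "tables p (Suc i) s2"
          by (rule tables_Suc[of p i s]) (use I 1 2 i in auto)
        ultimately show "wp W (incr ''i'' (Const 0)) (\<lambda>k3. wp W Skip
            (\<lambda>k4 s'. k1 + (k2 + (k3 + k4)) \<le> 96 * n + 90 \<and> ?I (Suc i) s')) s2"
          using 1 2 i W_ge by (auto simp: wp_simps)
      qed (use i assms in auto)
    qed (use I i assms in auto)
    then show "tfits W (Less (Var ''i'') (Var ''n'')) s \<and> tval (Less (Var ''i'') (Var ''n'')) s \<and>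
        wp W (block [fill_row_maxima, fill_col_maxima, incr ''i'' (Const 0)])
          (\<lambda>k s'. k \<le> 96 * n + 90 \<and> ?I (Suc i) s') s"
      using I i W_ge by (auto simp: predicting_def static_def)
  qed simp
  then show ?thesis
    by (rule wp_mono) (auto simp: algebra_simps)
qed

text \<open>The progress index of \<open>tables\<close> is lexicographic: with all \<open>n\<close>
  rows and columns done, the entry of \<open>''top''\<close> is what is still missing, and the index
  rolls over from \<open>(p, n)\<close> to \<open>(p + 1, 0)\<close>.\<close>

lemma wp_fill_top:
  assumes "predicting p s" "tables p n s" "p \<le> T"
  shows "wp W fill_top (\<lambda>k s'. k \<le> 48 * n + 41 \<and> predicting p s' \<and> tables (Suc p) 0 s') s"
proof -
  have l: "0 \<le> lrow p j \<and> lrow p j \<le> int T" for j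
    using count_bounds[of "take p \<rho>'" j] by simp_all
  let ?st = "\<lambda>j y. s(''i'' := (s ''i'')(0 := int j), ''out'' := (s ''out'')(0 := y))"
  let ?e = "Plus (cell ''rowmax'' (Var ''p'') (Var ''i'')) (Read ''lrow'' (Var ''i''))"
  have "wp W fill_top (\<lambda>k s'. k \<le> n * (2 * acost ?e + 22) + acost ?e + acost (Var ''p'') + 20 \<and>
    s' = (?st n (top_max p))(''top'' := (s ''top'')(int p := top_max p))) s"
    unfolding fill_top_def top_max_def
  proof (rule wp_fill)
    fix j y assume j: "j < n"
    have "s ''rowmax'' (int p * int n + int j) = row_max p j"
      using assms(2) j by (simp add: tables_def)
    then show "afits W ?e (?st j y) \<and> aval ?e (?st j y) = row_max p j + lrow p j"
      using assms(1,3) j W_ge l[of j] max_bounds(1)[OF j, of p] address_fits[of p j]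
        address_fits[of j j]
      by (auto simp: cell_def predicting_def static_def abs_le_iff)
  next
    fix y
    show "afits W (Var ''p'') (?st n y) \<and> aval (Var ''p'') (?st n y) = int p"
      using assms W_ge by (auto simp: predicting_def static_def)
  qed (use assms n W_ge in \<open>auto simp: predicting_def static_def\<close>)
  then show ?thesis
  proof (rule wp_mono)
    fix k s'
    assume s': "k \<le> n * (2 * acost ?e + 22) + acost ?e + acost (Var ''p'') + 20 \<and>
      s' = (?st n (top_max p))(''top'' := (s ''top'')(int p := top_max p))"
    then have "predicting p s'"
      using assms(1) by simp
    moreover have "tables (Suc p) 0 s'"
      using assms(2) s' by (auto simp: tables_def less_Suc_eq)
    ultimately show "k \<le> 48 * n + 41 \<and> predicting p s' \<and> tables (Suc p) 0 s'"
      using s' by (auto simp: cell_def)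
  qed
qed

lemma take_Suc_prediction:
  "take (Suc p) \<rho>' = (if p < T then take p \<rho>' @ [\<rho>' ! p] else take p \<rho>')"
  by (simp add: take_Suc_conv_app_nth)

lemma wp_count_prediction:
  assumes "predicting p s" "tables (Suc p) 0 s" "p \<le> T"
  shows "wp W (block [count_prediction, incr ''p'' (Const 0)])
    (\<lambda>k s'. k \<le> 50 \<and> predicting (Suc p) s' \<and> tables (Suc p) 0 s') s"
proof -
  have p: "s ''p'' 0 = int p"
    and kind: "s ''pred_kind'' (int p) = (if p < T then request_kind (\<rho>' ! p) else 0)"
    and cnt: "\<And>i. i < n \<Longrightarrow> s ''lrow'' (int i) = lrow p i \<and> s ''lcol'' (int i) = lcol p i"
    using assms(1) by (auto simp: predicting_def)
  have idx': "s ''pred_index'' (int p) = int (idx p)" "idx p < n" if "p < T"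
    using assms(1) that idx by (auto simp: predicting_def static_def)
  have l: "0 \<le> lrow p j \<and> lrow p j \<le> int T" "0 \<le> lcol p j \<and> lcol p j \<le> int T" for j
    using count_bounds[of "take p \<rho>'" j] by simp_all
  have W': "int p + 1 \<le> W" "2 \<le> W" "int T + 1 \<le> W" "int n \<le> W"
    using assms(3) W_ge by auto
  have upd: "predicting (Suc p) (s(''p'' := (s ''p'')(0 := int p + 1)))"
    if "lrow (Suc p) = lrow p" "lcol (Suc p) = lcol p"
    using assms(1) that by (simp add: predicting_def static_def)
  \<comment> \<open>The case \<open>p = T\<close> is the last pass, which reads a \<open>0\<close>
    just behind the prediction; the counts stay as they are, because \<open>take\<close> has already
    reached the end.\<close>
  consider "p = T" | "p < T" "\<rho>' ! p = Query" | i where "p < T" "\<rho>' ! p = IncRow i"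
    | i where "p < T" "\<rho>' ! p = IncCol i"
    using assms(3) by (cases "\<rho>' ! p") (force simp: le_less)+
  then show ?thesis
  proof cases
    case 1
    then have "lrow (Suc p) = lrow p" "lcol (Suc p) = lcol p"
      by auto
    from upd[OF this] 1 p kind W' assms(2) show ?thesis
      by (simp add: count_prediction_def wp_simps)
  next
    case 2
    then have "lrow (Suc p) = lrow p" "lcol (Suc p) = lcol p"
      by (auto simp: take_Suc_prediction row_count_def col_count_def fun_eq_iff)
    from upd[OF this] 2 p kind W' assms(2) show ?thesis
      by (simp add: count_prediction_def wp_simps)
  next
    case (3 i)
    then have i: "idx p = i" by (simp add: idx_def)
    have "lrow (Suc p) = (lrow p)(i := lrow p i + 1)" "lcol (Suc p) = lcol p"
      using 3 by (auto simp: take_Suc_prediction row_count_def col_count_def fun_eq_iff)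
    then have "predicting (Suc p) (s(''lrow'' := (s ''lrow'')(int i := lrow p i + 1),
        ''p'' := (s ''p'')(0 := int p + 1)))"
      using assms(1) by (simp add: predicting_def static_def)
    then show ?thesis
      using 3 p kind W' idx' i l[of i] cnt[of i] assms(2)
      by (simp add: count_prediction_def wp_simps)
  next
    case (4 i)
    then have i: "idx p = i" by (simp add: idx_def)
    have "lcol (Suc p) = (lcol p)(i := lcol p i + 1)" "lrow (Suc p) = lrow p"
      using 4 by (auto simp: take_Suc_prediction row_count_def col_count_def fun_eq_iff)
    then have "predicting (Suc p) (s(''lcol'' := (s ''lcol'')(int i := lcol p i + 1),
        ''p'' := (s ''p'')(0 := int p + 1)))"
      using assms(1) by (simp add: predicting_def static_def)
    then show ?thesis
      using 4 p kind W' idx' i l[of i] cnt[of i] assms(2)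
      by (simp add: count_prediction_def wp_simps)
  qed
qed

lemma predicting_input_state: "predicting 0 (input_state n d M \<rho>')"
proof -
  have "input_state n d M \<rho>' ''matrix'' (int i * int n + int j) = M i j" if "i < n" "j < n" for i j
  proof -
    have eq: "int i * int n + int j = int (i * n + j)" by simp
    have "Suc i * n \<le> n * n" using that by (intro mult_right_mono) auto
    then have "i * n + j < n * n" using that by simp
    then have "int (i * n + j) < int n * int n"
      by (metis of_nat_less_iff of_nat_mult)
    then show ?thesis
      using that unfolding eq by (simp add: input_state_def del: of_nat_add of_nat_mult)
  qed
  then show ?thesis
    by (simp add: predicting_def static_def input_state_def idx row_count_def col_count_def)
qed

text \<open>The actual requests enter only through their first \<open>t\<close> elements, so at
  \<open>t = 0\<close> this does not depend on \<open>\<rho>\<close>: the preprocessing can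
  establish it before any request is known.\<close>

definition live :: "request list \<Rightarrow> nat \<Rightarrow> state \<Rightarrow> bool" where
  "live \<rho> t s \<longleftrightarrow> static s \<and> tables (Suc T) 0 s \<and> s ''t'' 0 = int t \<and>
     (\<forall>i<n. s ''rowcnt'' (int i) = row_count (take t \<rho>) i \<and>
       s ''colcnt'' (int i) = col_count (take t \<rho>) i)"

lemma top_max_0: "top_max 0 = max_entry n M"
proof (rule max_entry_eqI[OF n])
  show "M i j \<le> top_max 0" if "i < n" "j < n" for i j
    using top_max_ge[OF that, of 0] by (simp add: row_count_def col_count_def)
  show "top_max 0 \<le> max_entry n M"
    using top_max_in[of 0] entry_le_max_entry[of _ n _ M] by (auto simp: row_count_def col_count_def)
qed

text \<open>A single final state has to work for every actual sequence, hence the quantifier over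
  \<open>\<rho>\<close> inside. Each pass costs at most \<open>n * (96 * n + 148) + 100\<close>, and
  the loop test adds \<open>8\<close>.\<close>

lemma wp_preprocess:
  "wp W preprocess (\<lambda>k s. k \<le> (T + 1) * (n * (96 * n + 148) + 108) + 30 \<and>
     (\<forall>\<rho>. live \<rho> 0 s) \<and> s ''out'' 0 = max_entry n M) (input_state n d M \<rho>')"
proof -
  let ?I = "\<lambda>p s. predicting p s \<and> tables p 0 s"
  let ?b = "Less (Var ''p'') (Plus (Var ''T'') (Const 1))"
  let ?c = "block [Set ''i'' (Const 0), fill_maxima, fill_top, count_prediction,
    incr ''p'' (Const 0)]"
  have loop: "wp W (While ?b ?c) (\<lambda>k s'. k \<le> (Suc T - 0) * ((n * (96 * n + 148) + 100) +
      tcost ?b + 1) + tcost ?b + 1 \<and> ?I (Suc T) s') (input_state n d M \<rho>')"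
  proof (rule wp_While[where I = ?I and lo = 0])
    show "?I 0 (input_state n d M \<rho>')"
      using predicting_input_state by (simp add: tables_def)
    show "tfits W ?b s \<and> \<not> tval ?b s" if "?I (Suc T) s" for s
      using that W_ge by (auto simp: predicting_def static_def)
  next
    fix p s assume p: "p < Suc T" and I: "?I p s"
    have "wp W ?c (\<lambda>k s'. k \<le> n * (96 * n + 148) + 100 \<and> ?I (Suc p) s') s"
    proof -
      define s0 where "s0 = s(''i'' := (s ''i'')(0 := 0))"
      have s0: "predicting p s0" "tables p 0 s0" "s0 ''i'' 0 = 0"
        using I by (simp_all add: s0_def)
      have "wp W fill_maxima (\<lambda>k2. wp W fill_top (\<lambda>k3. wp W (block [count_prediction,
          incr ''p'' (Const 0)]) (\<lambda>k s'. 3 + (k2 + (k3 + k)) \<le> n * (96 * n + 148) + 100 \<and>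
          ?I (Suc p) s'))) s0"
      proof (rule wp_mono[OF wp_fill_maxima[OF s0]])
        fix k2 s2
        assume 2: "k2 \<le> n * (96 * n + 100) + 6 \<and> predicting p s2 \<and> tables p n s2"
        show "wp W fill_top (\<lambda>k3. wp W (block [count_prediction,
          incr ''p'' (Const 0)]) (\<lambda>k s'. 3 + (k2 + (k3 + k)) \<le> n * (96 * n + 148) + 100 \<and>
          ?I (Suc p) s')) s2"
        proof (rule wp_mono[OF wp_fill_top[of p]])
          fix k3 s3
          assume 3: "k3 \<le> 48 * n + 41 \<and> predicting p s3 \<and> tables (Suc p) 0 s3"
          show "wp W (block [count_prediction, incr ''p'' (Const 0)])
            (\<lambda>k s'. 3 + (k2 + (k3 + k)) \<le> n * (96 * n + 148) + 100 \<and> ?I (Suc p) s') s3"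
            by (rule wp_mono[OF wp_count_prediction[of p]])
              (use 2 3 p in \<open>auto simp: algebra_simps\<close>)
        qed (use 2 p in auto)
      qed (use p in auto)
      then show ?thesis
        using W_ge by (simp add: wp_Seq wp_Assign s0_def)
    qed
    then show "tfits W ?b s \<and> tval ?b s \<and>
        wp W ?c (\<lambda>k s'. k \<le> n * (96 * n + 148) + 100 \<and> ?I (Suc p) s') s"
      using I p W_ge by (auto simp: predicting_def static_def)
  qed simp
  have "wp W preprocess (\<lambda>k s. k \<le> (T + 1) * (n * (96 * n + 148) + 108) + 30 \<and>
     (\<forall>\<rho>. live \<rho> 0 s) \<and> s ''out'' 0 = top_max 0) (input_state n d M \<rho>')"
    unfolding preprocess_def block.simps wp_Seq
  proof (rule wp_mono[OF loop[unfolded block.simps]])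
    fix k s
    assume s: "k \<le> (Suc T - 0) * ((n * (96 * n + 148) + 100) + tcost ?b + 1) + tcost ?b + 1 \<and>
      ?I (Suc T) s"
    have "live \<rho> 0 s" for \<rho>
      using s by (simp add: live_def predicting_def row_count_def col_count_def)
    then have "live \<rho> 0 (s(''out'' := f))" for \<rho> f
      by (simp add: live_def)
    moreover have "s ''top'' 0 = top_max 0"
      using s unfolding tables_def by (metis of_nat_0 zero_less_Suc)
    ultimately show "wp W (Set ''out'' (Read ''top'' (Const 0))) (\<lambda>k1. wp W Skip (\<lambda>k2 s.
      k + (k1 + k2) \<le> (T + 1) * (n * (96 * n + 148) + 108) + 30 \<and>
     (\<forall>\<rho>. live \<rho> 0 s) \<and> s ''out'' 0 = top_max 0)) s"
      using s W_ge max_bounds(3)[of 0] by (auto simp: wp_simps algebra_simps)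
  qed
  then show ?thesis by (simp add: top_max_0)
qed

section \<open>Verification of the handlers\<close>

lemma live_upd [simp]:
  "x \<notin> {''n'', ''d'', ''T'', ''matrix'', ''pred_index'', ''rowmax'', ''colmax'', ''top'', ''t'',
     ''rowcnt'', ''colcnt''} \<Longrightarrow> live \<rho> t (s(x := f)) \<longleftrightarrow> live \<rho> t s"
proof -
  assume "x \<notin> {''n'', ''d'', ''T'', ''matrix'', ''pred_index'', ''rowmax'', ''colmax'', ''top'',
    ''t'', ''rowcnt'', ''colcnt''}"
  then have "(s(x := f)) y = s y" if "y \<in> {''n'', ''d'', ''T'', ''matrix'', ''pred_index'',
      ''rowmax'', ''colmax'', ''top'', ''t'', ''rowcnt'', ''colcnt''}" for y
    using that by (metis fun_upd_other)
  then show ?thesis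
    by (simp add: live_def static_def tables_def del: fun_upd_apply)
qed

lemma wp_tick:
  assumes "live \<rho> t s" "t < length \<rho>" "length \<rho> = T" "\<rho> ! t = Query"
  shows "wp W tick (\<lambda>k s'. k \<le> 10 \<and> live \<rho> (Suc t) s' \<and> s' ''out'' = s ''out'') (receive Query s)"
proof -
  have "live \<rho> t (receive Query s)"
    using assms by (simp add: receive_def)
  moreover have "row_count (take (Suc t) \<rho>) = row_count (take t \<rho>)"
    "col_count (take (Suc t) \<rho>) = col_count (take t \<rho>)"
    using assms by (auto simp: take_Suc_conv_app_nth row_count_def col_count_def)
  moreover have "receive Query s ''out'' = s ''out''"
    by (simp add: receive_def)
  ultimately show ?thesis
    using assms W_ge by (simp add: tick_def wp_simps live_def)
qed

lemma wp_count_request: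
  assumes "live \<rho> t s" "t < length \<rho>" "length \<rho> = T" "\<rho> ! t \<noteq> Query" "valid_request n (\<rho> ! t)"
  shows "wp W count_request (\<lambda>k s'. k \<le> 30 \<and> live \<rho> (Suc t) s' \<and> s' ''out'' = s ''out'' \<and>
      s' ''kind'' 0 = request_kind (\<rho> ! t) \<and> s' ''index'' 0 = request_index (\<rho> ! t))
    (receive (\<rho> ! t) s)"
proof -
  define s0 where "s0 = receive (\<rho> ! t) s"
  have s0: "live \<rho> t s0" "s0 ''out'' = s ''out''" "s0 ''kind'' 0 = request_kind (\<rho> ! t)"
      "s0 ''index'' 0 = request_index (\<rho> ! t)"
    using assms by (simp_all add: s0_def receive_def)
  have cnt: "0 \<le> row_count (take t \<rho>) i \<and> row_count (take t \<rho>) i \<le> int T"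
      "0 \<le> col_count (take t \<rho>) i \<and> col_count (take t \<rho>) i \<le> int T" for i
    using count_bounds[of "take t \<rho>" i] assms by auto
  show ?thesis
    unfolding s0_def[symmetric]
  proof (cases "\<rho> ! t")
    case (IncRow i)
    have "row_count (take (Suc t) \<rho>) = (row_count (take t \<rho>))(i := row_count (take t \<rho>) i + 1)"
      "col_count (take (Suc t) \<rho>) = col_count (take t \<rho>)"
      using assms IncRow by (auto simp: take_Suc_conv_app_nth row_count_def col_count_def fun_eq_iff)
    then show "wp W count_request (\<lambda>k s'. k \<le> 30 \<and> live \<rho> (Suc t) s' \<and> s' ''out'' = s ''out'' \<and>
      s' ''kind'' 0 = request_kind (\<rho> ! t) \<and> s' ''index'' 0 = request_index (\<rho> ! t)) s0"
      using assms s0 W_ge cnt[of i] IncRow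
      by (simp add: count_request_def tick_def wp_simps live_def)
  next
    case (IncCol i)
    have "col_count (take (Suc t) \<rho>) = (col_count (take t \<rho>))(i := col_count (take t \<rho>) i + 1)"
      "row_count (take (Suc t) \<rho>) = row_count (take t \<rho>)"
      using assms IncCol by (auto simp: take_Suc_conv_app_nth row_count_def col_count_def fun_eq_iff)
    then show "wp W count_request (\<lambda>k s'. k \<le> 30 \<and> live \<rho> (Suc t) s' \<and> s' ''out'' = s ''out'' \<and>
      s' ''kind'' 0 = request_kind (\<rho> ! t) \<and> s' ''index'' 0 = request_index (\<rho> ! t)) s0"
      using assms s0 W_ge cnt[of i] IncCol
      by (simp add: count_request_def tick_def wp_simps live_def)
  qed (use assms in simp)
qed

lemma wp_set_window:
  assumes "live \<rho> t s" "t \<le> T"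
  shows "wp W set_window (\<lambda>k s'. k \<le> 50 \<and> s' = s(
    ''lo'' := (s ''lo'')(0 := int (t - d)),
    ''hi'' := (s ''hi'')(0 := int (min T (t + d))),
    ''q'' := (s ''q'')(0 := int (t - d)))) s"
proof -
  have s: "s ''t'' 0 = int t" "s ''d'' 0 = int d" "s ''T'' 0 = int T"
    using assms by (simp_all add: live_def static_def)
  show ?thesis
    using s W_ge assms(2) unfolding set_window_def
    \<comment> \<open>The four cases are the outcomes of the two clamping tests; clamping at
      \<open>0\<close> is precisely truncated subtraction on naturals.\<close>
    by (cases "t < d"; cases "T < t + d")
      (simp_all add: wp_simps of_nat_diff min_def fun_upd_twist)
qed

section \<open>Exactness of prefix counts outside the window\<close>

text \<open>\<open>idx\<close> forgets whether a request concerns a row or a column, so the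
  exceptional set may be too large, but it contains every row incremented in the window. That is all
  that exactness outside of it requires.\<close>

lemma window_rows:
  assumes "delayed d \<rho> \<rho>'" "t \<le> T"
  shows "lrow (t - d) i \<le> row_count (take t \<rho>) i"
    and "i \<notin> idx ` {t - d..<min T (t + d)} \<Longrightarrow> row_count (take t \<rho>) i = lrow (t - d) i"
proof -
  note counts = delayed_counts[OF assms(1), of t "IncRow i"]
  show "lrow (t - d) i \<le> row_count (take t \<rho>) i"
    using counts(1) assms delayed_length[OF assms(1)] by (simp add: row_count_def)
  assume i: "i \<notin> idx ` {t - d..<min T (t + d)}"
  have "\<rho>' ! q \<noteq> IncRow i" if "t - d \<le> q" "q < T" "q < t + d" for q
  proof
    assume "\<rho>' ! q = IncRow i"
    then have "idx q = i" by (simp add: idx_def)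
    moreover have "q \<in> {t - d..<min T (t + d)}" using that by simp
    ultimately show False using i by blast
  qed
  then show "row_count (take t \<rho>) i = lrow (t - d) i"
    using counts(2) assms delayed_length[OF assms(1)] by (simp add: row_count_def)
qed

lemma window_cols:
  assumes "delayed d \<rho> \<rho>'" "t \<le> T"
  shows "lcol (t - d) j \<le> col_count (take t \<rho>) j"
    and "j \<notin> idx ` {t - d..<min T (t + d)} \<Longrightarrow> col_count (take t \<rho>) j = lcol (t - d) j"
proof -
  note counts = delayed_counts[OF assms(1), of t "IncCol j"]
  show "lcol (t - d) j \<le> col_count (take t \<rho>) j"
    using counts(1) assms delayed_length[OF assms(1)] by (simp add: col_count_def)
  assume j: "j \<notin> idx ` {t - d..<min T (t + d)}"
  have "\<rho>' ! q \<noteq> IncCol j" if "t - d \<le> q" "q < T" "q < t + d" for q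
  proof
    assume "\<rho>' ! q = IncCol j"
    then have "idx q = j" by (simp add: idx_def)
    moreover have "q \<in> {t - d..<min T (t + d)}" using that by simp
    ultimately show False using j by blast
  qed
  then show "col_count (take t \<rho>) j = lcol (t - d) j"
    using counts(2) assms delayed_length[OF assms(1)] by (simp add: col_count_def)
qed

text \<open>Prefix counts of the prediction are lower bounds for the current counts, so none of the
  stored maxima can exceed the true maximum; no entry has to be excluded from them.\<close>

lemma stored_maxima_le:
  assumes "delayed d \<rho> \<rho>'" "t \<le> T"
  defines "N \<equiv> matrix_after M (take t \<rho>)"
  shows "i < n \<Longrightarrow> row_max (t - d) i + row_count (take t \<rho>) i \<le> max_entry n N"
    and "i < n \<Longrightarrow> col_max (t - d) i + col_count (take t \<rho>) i \<le> max_entry n N"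
    and "top_max (t - d) \<le> max_entry n N"
proof -
  note rows = window_rows(1)[OF assms(1,2)] and cols = window_cols(1)[OF assms(1,2)]
  show "row_max (t - d) i + row_count (take t \<rho>) i \<le> max_entry n N" if i: "i < n"
  proof -
    obtain j where j: "j < n" "row_max (t - d) i = M i j + lcol (t - d) j"
      using row_max_in by blast
    then show ?thesis
      using entry_le_max_entry[OF i j(1), of N] cols[of j] by (simp add: N_def matrix_after_def)
  qed
  show "col_max (t - d) i + col_count (take t \<rho>) i \<le> max_entry n N" if i: "i < n"
  proof -
    obtain j where j: "j < n" "col_max (t - d) i = M j i + lrow (t - d) j"
      using col_max_in by blast
    then show ?thesis
      using entry_le_max_entry[OF j(1) i, of N] rows[of j] by (simp add: N_def matrix_after_def)
  qed
  obtain i j where ij: "i < n" "j < n" "top_max (t - d) = M i j + lrow (t - d) i + lcol (t - d) j"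
    using top_max_in by blast
  then show "top_max (t - d) \<le> max_entry n N"
    using entry_le_max_entry[OF ij(1,2), of N] rows[of i] cols[of j]
    by (simp add: N_def matrix_after_def)
qed

lemma max_entry_bound:
  assumes "length xs \<le> T"
  shows "\<bar>max_entry n (matrix_after M xs)\<bar> \<le> W"
proof -
  obtain i j where ij: "i < n" "j < n"
      "max_entry n (matrix_after M xs) = M i j + row_count xs i + col_count xs j"
    using max_entry_attained[OF n, of "matrix_after M xs"] by (auto simp: matrix_after_def)
  show ?thesis
    using entries[OF ij(1,2)] count_bounds[OF assms, of i] count_bounds[OF assms, of j] ij(3) W_ge
    by linarith
qed

lemma current_eval:
  assumes "live \<rho> t s" "length \<rho> = T" "i < n" "j < n"
    and "afits W a s" "aval a s = int i" "afits W b s" "aval b s = int j"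
  shows "afits W (current a b) s \<and> aval (current a b) s = matrix_after M (take t \<rho>) i j"
proof -
  have "length (take t \<rho>) \<le> T" using assms(2) by simp
  from count_bounds[OF this, of i] count_bounds[OF this, of j] show ?thesis
    using assms entries[OF assms(3,4)] W_ge address_fits[of i j] address_fits[of j j]
    by (simp add: current_def cell_def live_def static_def matrix_after_def abs_le_iff)
qed

lemma row_bound_eval:
  assumes "live \<rho> t s" "length \<rho> = T" "s ''lo'' 0 = int p" "p \<le> T" "i < n"
    and "afits W a s" "aval a s = int i"
  shows "afits W (row_bound a) s \<and> aval (row_bound a) s = row_max p i + row_count (take t \<rho>) i"
proof -
  have "s ''rowmax'' (int p * int n + int i) = row_max p i"
    using assms by (simp add: live_def tables_def)
  moreover have "length (take t \<rho>) \<le> T" using assms(2) by simp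
  note count_bounds[OF this, of i]
  ultimately show ?thesis
    using assms max_bounds(1)[OF assms(5), of p] W_ge address_fits[of p i] address_fits[of i i]
    by (simp add: row_bound_def cell_def live_def static_def abs_le_iff)
qed

lemma col_bound_eval:
  assumes "live \<rho> t s" "length \<rho> = T" "s ''lo'' 0 = int p" "p \<le> T" "j < n"
    and "afits W a s" "aval a s = int j"
  shows "afits W (col_bound a) s \<and> aval (col_bound a) s = col_max p j + col_count (take t \<rho>) j"
proof -
  have "s ''colmax'' (int p * int n + int j) = col_max p j"
    using assms by (simp add: live_def tables_def)
  moreover have "length (take t \<rho>) \<le> T" using assms(2) by simp
  note count_bounds[OF this, of j]
  ultimately show ?thesis
    using assms max_bounds(2)[OF assms(5), of p] W_ge address_fits[of p j] address_fits[of j j]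
    by (simp add: col_bound_def cell_def live_def static_def abs_le_iff)
qed

text \<open>The window is that of time \<open>Suc t\<close>, as the increment has been counted.
  Outside it the column counts in the stored row maximum are exact, so adding the current row count
  bounds the entries of row \<open>i\<close> there. Conversely, the old maximum, the stored bound
  and the entries read are all at most the new maximum.\<close>

lemma max_after_row_update:
  assumes "delayed d \<rho> \<rho>'" "t < T" "\<rho> ! t = IncRow i" "i < n"
  defines "N \<equiv> matrix_after M (take (Suc t) \<rho>)"
  shows "Max (insert (max (max_entry n (matrix_after M (take t \<rho>)))
      (row_max (Suc t - d) i + row_count (take (Suc t) \<rho>) i))
      ((\<lambda>q. N i (idx q)) ` {Suc t - d..<min T (Suc t + d)})) = max_entry n N" (is "?v = _")
proof (rule max_entry_eqI[OF n])
  let ?N0 = "matrix_after M (take t \<rho>)"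
  have N: "N = apply_request (IncRow i) ?N0"
    using assms delayed_length[OF assms(1)]
    by (simp add: apply_request_matrix_after take_Suc_conv_app_nth)
  have old: "max_entry n ?N0 \<le> ?v"
    and row: "row_max (Suc t - d) i + row_count (take (Suc t) \<rho>) i \<le> ?v"
    and win: "\<And>q. q \<in> {Suc t - d..<min T (Suc t + d)} \<Longrightarrow> N i (idx q) \<le> ?v"
    by (meson Max_ge finite_imageI finite_atLeastLessThan finite_insert insertI1 insertI2 imageI
        max.cobounded1 max.cobounded2 order_trans)+
  show "N a b \<le> ?v" if ab: "a < n" "b < n" for a b
  proof (cases "a = i")
    case False
    then show ?thesis
      using old entry_le_max_entry[OF ab, of ?N0] by (simp add: N)
  next
    case True
    show ?thesis
    proof (cases "b \<in> idx ` {Suc t - d..<min T (Suc t + d)}")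
      case True
      then show ?thesis using win \<open>a = i\<close> by blast
    next
      case False
      then have "col_count (take (Suc t) \<rho>) b = lcol (Suc t - d) b"
        using window_cols(2)[OF assms(1)] assms(2) by simp
      then have "N a b = M i b + row_count (take (Suc t) \<rho>) i + lcol (Suc t - d) b"
        using \<open>a = i\<close> by (simp add: N_def matrix_after_def)
      then show ?thesis
        using row row_max_ge[OF ab(2), of i "Suc t - d"] by linarith
    qed
  qed
  \<comment> \<open>The place where the old maximum was attained still witnesses it, since an
    increment lowers no entry.\<close>
  obtain a b where ab: "a < n" "b < n" "max_entry n ?N0 = ?N0 a b"
    using max_entry_attained[OF n] by blast
  then have "max_entry n ?N0 \<le> max_entry n N"
    using entry_le_max_entry[OF ab(1,2), of N] by (simp add: N split: if_splits)
  moreover have "row_max (Suc t - d) i + row_count (take (Suc t) \<rho>) i \<le> max_entry n N"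
    unfolding N_def by (rule stored_maxima_le) (use assms in auto)
  ultimately show "?v \<le> max_entry n N"
    using entry_le_max_entry[OF assms(4) idx(1)] by simp
qed

lemma max_after_col_update:
  assumes "delayed d \<rho> \<rho>'" "t < T" "\<rho> ! t = IncCol j" "j < n"
  defines "N \<equiv> matrix_after M (take (Suc t) \<rho>)"
  shows "Max (insert (max (max_entry n (matrix_after M (take t \<rho>)))
      (col_max (Suc t - d) j + col_count (take (Suc t) \<rho>) j))
      ((\<lambda>q. N (idx q) j) ` {Suc t - d..<min T (Suc t + d)})) = max_entry n N" (is "?v = _")
proof (rule max_entry_eqI[OF n])
  let ?N0 = "matrix_after M (take t \<rho>)"
  have N: "N = apply_request (IncCol j) ?N0"
    using assms delayed_length[OF assms(1)]
    by (simp add: apply_request_matrix_after take_Suc_conv_app_nth)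
  have old: "max_entry n ?N0 \<le> ?v"
    and col: "col_max (Suc t - d) j + col_count (take (Suc t) \<rho>) j \<le> ?v"
    and win: "\<And>q. q \<in> {Suc t - d..<min T (Suc t + d)} \<Longrightarrow> N (idx q) j \<le> ?v"
    by (meson Max_ge finite_imageI finite_atLeastLessThan finite_insert insertI1 insertI2 imageI
        max.cobounded1 max.cobounded2 order_trans)+
  show "N a b \<le> ?v" if ab: "a < n" "b < n" for a b
  proof (cases "b = j")
    case False
    then show ?thesis
      using old entry_le_max_entry[OF ab, of ?N0] by (simp add: N)
  next
    case True
    show ?thesis
    proof (cases "a \<in> idx ` {Suc t - d..<min T (Suc t + d)}")
      case True
      then show ?thesis using win \<open>b = j\<close> by blast
    next
      case False
      then have "row_count (take (Suc t) \<rho>) a = lrow (Suc t - d) a"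
        using window_rows(2)[OF assms(1)] assms(2) by simp
      then have "N a b = M a j + lrow (Suc t - d) a + col_count (take (Suc t) \<rho>) j"
        using \<open>b = j\<close> by (simp add: N_def matrix_after_def)
      then show ?thesis
        using col col_max_ge[OF ab(1), of j "Suc t - d"] by linarith
    qed
  qed
  obtain a b where ab: "a < n" "b < n" "max_entry n ?N0 = ?N0 a b"
    using max_entry_attained[OF n] by blast
  then have "max_entry n ?N0 \<le> max_entry n N"
    using entry_le_max_entry[OF ab(1,2), of N] by (simp add: N split: if_splits)
  moreover have "col_max (Suc t - d) j + col_count (take (Suc t) \<rho>) j \<le> max_entry n N"
    unfolding N_def by (rule stored_maxima_le) (use assms in auto)
  ultimately show "?v \<le> max_entry n N"
    using entry_le_max_entry[OF idx(1) assms(4)] by simp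
qed

text \<open>The factor of \<open>d\<close> stems from at most \<open>2 * d\<close> window positions
  at \<open>60 = 2 * 19 + 2 + 20\<close> units each, where \<open>19\<close> is the cost of the
  inspected entry, rounded up to \<open>64\<close>.\<close>

lemma wp_update_maximum:
  assumes \<rho>: "delayed d \<rho> \<rho>'" and "live \<rho> t s" and t: "t < length \<rho>" and "\<rho> ! t \<noteq> Query"
    and out: "s ''out'' 0 = max_entry n (matrix_after M (take t \<rho>))"
  shows "wp W update_maximum (\<lambda>k s'. k \<le> 200 + 128 * d \<and> live \<rho> (Suc t) s' \<and>
    s' ''out'' 0 = max_entry n (matrix_after M (take (Suc t) \<rho>))) (receive (\<rho> ! t) s)"
proof -
  let ?N = "matrix_after M (take (Suc t) \<rho>)"
  define lo where "lo = Suc t - d"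
  define hi where "hi = min T (Suc t + d)"
  have len: "length \<rho> = T"
    using delayed_length[OF \<rho>] .
  have vr: "valid_request n (\<rho> ! t)"
    using valid delayed_set[OF \<rho>] t nth_mem by metis
  have lohi: "lo \<le> T" "lo \<le> hi" "hi - lo \<le> 2 * d" "hi \<le> T"
    using t len by (auto simp: lo_def hi_def)
  have pos: "1 \<le> W" "2 \<le> W" "int hi \<le> W" "int lo \<le> W"
    using W_ge lohi by linarith+
  have outW: "\<bar>max_entry n (matrix_after M (take t \<rho>))\<bar> \<le> W"
    by (rule max_entry_bound) (simp add: len)
  \<comment> \<open>Treats the branch on the kind for any state with the window set up, so that only
    these facts about the preceding commands are carried along.\<close>
  have main: "wp W (If (Equal (Var ''kind'') (Const 1))
       (block [raise (row_bound (Var ''index'')),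
          raise_loop ''q'' (Var ''hi'') (current (Var ''index'') (Read ''pred_index'' (Var ''q'')))])
       (block [raise (col_bound (Var ''index'')),
          raise_loop ''q'' (Var ''hi'') (current (Read ''pred_index'' (Var ''q'')) (Var ''index''))]))
      (\<lambda>k s'. k \<le> 118 + 128 * d \<and> live \<rho> (Suc t) s' \<and> s' ''out'' 0 = max_entry n ?N) s2"
    if s2: "live \<rho> (Suc t) s2" "s2 ''out'' 0 = max_entry n (matrix_after M (take t \<rho>))"
      "s2 ''kind'' 0 = request_kind (\<rho> ! t)" "s2 ''index'' 0 = request_index (\<rho> ! t)"
      "s2 ''lo'' 0 = int lo" "s2 ''hi'' 0 = int hi" "s2 ''q'' 0 = int lo" for s2
  proof -
    have pi: "s2 ''pred_index'' (int q) = int (idx q)" "idx q < n" "int (idx q) \<le> W" "int q \<le> W"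
      if "q < hi" for q
      using s2(1) that idx(1)[of q] W_ge lohi(4) by (auto simp: live_def static_def)
    show ?thesis
    proof (cases "\<rho> ! t")
      case (IncRow i)
      have i: "i < n" "int i \<le> W" using vr IncRow W_ge by auto
      let ?x = "row_max lo i + row_count (take (Suc t) \<rho>) i"
      let ?e = "current (Var ''index'') (Read ''pred_index'' (Var ''q''))"
      have bound: "afits W (row_bound (Var ''index'')) s2 \<and>
          aval (row_bound (Var ''index'')) s2 = ?x"
        by (rule row_bound_eval[OF s2(1) len s2(5) lohi(1) i(1)]) (use s2 pos i IncRow in auto)
      define s3 where "s3 = s2(''out'' := (s2 ''out'')(0 := max (s2 ''out'' 0) ?x))"
      have x: "\<bar>?x\<bar> \<le> W"
        using bound aval_fits by metis
      have raise: "wp W (raise (row_bound (Var ''index''))) (\<lambda>k s'. k \<le> 34 \<and> s' = s3) s2"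
        by (rule wp_mono[OF wp_raise])
          (use bound s2(2) outW in \<open>simp_all add: s3_def\<close>)
      have s3: "live \<rho> (Suc t) s3" "s3 ''q'' 0 = int lo" "s3 ''hi'' 0 = int hi"
          "s3 ''index'' 0 = int i" "s3 ''pred_index'' = s2 ''pred_index''"
          "s3 ''out'' 0 = max (max_entry n (matrix_after M (take t \<rho>))) ?x"
        using s2 IncRow by (simp_all add: s3_def)
      have s3W: "\<bar>s3 ''out'' 0\<bar> \<le> W"
        using outW x by (simp add: s3(6) max_def)
      have loop: "wp W (raise_loop ''q'' (Var ''hi'') ?e) (\<lambda>k s'. k \<le> (hi - lo) *
          (2 * acost ?e + acost (Var ''hi'') + 20) + acost (Var ''hi'') + 4 \<and>
          s' = s3(''q'' := (s3 ''q'')(0 := int hi), ''out'' := (s3 ''out'')(0 :=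
            Max (insert (s3 ''out'' 0) ((\<lambda>q. ?N i (idx q)) ` {lo..<hi}))))) s3"
      proof (rule wp_raise_loop)
        fix q y assume q: "lo \<le> q" "q < hi"
        let ?s = "s3(''q'' := (s3 ''q'')(0 := int q), ''out'' := (s3 ''out'')(0 := y))"
        show "afits W ?e ?s \<and> aval ?e ?s = ?N i (idx q)"
          by (rule current_eval) (use s3 len pi[OF q(2)] i pos in simp_all)
      qed (use s3(2,3) s3W pos lohi in simp_all)
      show ?thesis
        using IncRow s2(3) pos
        apply (simp add: wp_If wp_Seq)
        apply (rule wp_mono[OF raise])
        apply (elim conjE, hypsubst)
        apply (rule wp_mono[OF loop])
        using max_after_row_update[OF \<rho> _ IncRow i(1), folded lo_def hi_def] t len s3 lohi(3)
        by (auto simp: wp_Skip)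
    next
      case (IncCol i)
      have i: "i < n" "int i \<le> W" using vr IncCol W_ge by auto
      let ?x = "col_max lo i + col_count (take (Suc t) \<rho>) i"
      let ?e = "current (Read ''pred_index'' (Var ''q'')) (Var ''index'')"
      have bound: "afits W (col_bound (Var ''index'')) s2 \<and>
          aval (col_bound (Var ''index'')) s2 = ?x"
        by (rule col_bound_eval[OF s2(1) len s2(5) lohi(1) i(1)]) (use s2 pos i IncCol in auto)
      define s3 where "s3 = s2(''out'' := (s2 ''out'')(0 := max (s2 ''out'' 0) ?x))"
      have x: "\<bar>?x\<bar> \<le> W"
        using bound aval_fits by metis
      have raise: "wp W (raise (col_bound (Var ''index''))) (\<lambda>k s'. k \<le> 34 \<and> s' = s3) s2"
        by (rule wp_mono[OF wp_raise])
          (use bound s2(2) outW in \<open>simp_all add: s3_def\<close>)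
      have s3: "live \<rho> (Suc t) s3" "s3 ''q'' 0 = int lo" "s3 ''hi'' 0 = int hi"
          "s3 ''index'' 0 = int i" "s3 ''pred_index'' = s2 ''pred_index''"
          "s3 ''out'' 0 = max (max_entry n (matrix_after M (take t \<rho>))) ?x"
        using s2 IncCol by (simp_all add: s3_def)
      have s3W: "\<bar>s3 ''out'' 0\<bar> \<le> W"
        using outW x by (simp add: s3(6) max_def)
      have loop: "wp W (raise_loop ''q'' (Var ''hi'') ?e) (\<lambda>k s'. k \<le> (hi - lo) *
          (2 * acost ?e + acost (Var ''hi'') + 20) + acost (Var ''hi'') + 4 \<and>
          s' = s3(''q'' := (s3 ''q'')(0 := int hi), ''out'' := (s3 ''out'')(0 :=
            Max (insert (s3 ''out'' 0) ((\<lambda>q. ?N (idx q) i) ` {lo..<hi}))))) s3"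
      proof (rule wp_raise_loop)
        fix q y assume q: "lo \<le> q" "q < hi"
        let ?s = "s3(''q'' := (s3 ''q'')(0 := int q), ''out'' := (s3 ''out'')(0 := y))"
        show "afits W ?e ?s \<and> aval ?e ?s = ?N (idx q) i"
          by (rule current_eval) (use s3 len pi[OF q(2)] i pos in simp_all)
      qed (use s3(2,3) s3W pos lohi in simp_all)
      show ?thesis
        using IncCol s2(3) pos
        apply (simp add: wp_If wp_Seq)
        apply (rule wp_mono[OF raise])
        apply (elim conjE, hypsubst)
        apply (rule wp_mono[OF loop])
        using max_after_col_update[OF \<rho> _ IncCol i(1), folded lo_def hi_def] t len s3 lohi(3)
        by (auto simp: wp_Skip)
    qed (use assms in simp)
  qed
  show ?thesis
    unfolding update_maximum_def block.simps(2)[of count_request] block.simps(2)[of set_window] wp_Seq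
    apply (rule wp_mono[OF wp_count_request[OF assms(2) t len assms(4) vr]])
    apply (elim conjE)
    apply (rule wp_mono[OF wp_set_window[of \<rho> "Suc t", folded lo_def hi_def]])
      apply assumption
    using t len apply simp
    apply (elim conjE, hypsubst)
    unfolding block.simps(2)[of "If _ _ _"] block.simps(1) wp_Seq
    apply (rule wp_mono[OF main])
    using out by (auto simp: wp_Skip)
qed

text \<open>Four cases, by whether the row and the column of an entry occur in the window: both give
  a crossing, one gives the stored maximum of that line, as the other count is exact, and neither
  gives the stored overall maximum.\<close>

lemma window_max:
  assumes "delayed d \<rho> \<rho>'" "t \<le> T"
  defines "N \<equiv> matrix_after M (take t \<rho>)"
  assumes "top_max (t - d) \<le> v" "v \<le> max_entry n N"
    and row: "\<And>q. q \<in> {t - d..<min T (t + d)} \<Longrightarrow>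
      row_max (t - d) (idx q) + row_count (take t \<rho>) (idx q) \<le> v"
    and col: "\<And>q. q \<in> {t - d..<min T (t + d)} \<Longrightarrow>
      col_max (t - d) (idx q) + col_count (take t \<rho>) (idx q) \<le> v"
    and both: "\<And>q r. q \<in> {t - d..<min T (t + d)} \<Longrightarrow> r \<in> {t - d..<min T (t + d)} \<Longrightarrow>
      N (idx q) (idx r) \<le> v"
  shows "v = max_entry n N"
proof (rule max_entry_eqI[OF n _ assms(5)])
  let ?I = "{t - d..<min T (t + d)}"
  fix i j assume ij: "i < n" "j < n"
  have N: "N i j = M i j + row_count (take t \<rho>) i + col_count (take t \<rho>) j"
    by (simp add: N_def matrix_after_def)
  show "N i j \<le> v"
  proof (cases "i \<in> idx ` ?I")
    case True
    then obtain q where q: "q \<in> ?I" "i = idx q" by blast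
    show ?thesis
    proof (cases "j \<in> idx ` ?I")
      case True
      then show ?thesis using both q by blast
    next
      case False
      then show ?thesis
        using N window_cols(2)[OF assms(1,2)] row[OF q(1)] row_max_ge[OF ij(2), of i "t - d"] q(2)
        by simp
    qed
  next
    case i: False
    show ?thesis
    proof (cases "j \<in> idx ` ?I")
      case True
      then obtain q where q: "q \<in> ?I" "j = idx q" by blast
      show ?thesis
        using N window_rows(2)[OF assms(1,2) i] col[OF q(1)] col_max_ge[OF ij(1), of j "t - d"] q(2)
        by simp
    next
      case False
      then show ?thesis
        using N window_rows(2)[OF assms(1,2) i] window_cols(2)[OF assms(1,2)]
          top_max_ge[OF ij, of "t - d"] assms(4) by simp
    qed
  qed
qed

text \<open>An inspected crossing costs \<open>64 = 2 * 21 + 2 + 20\<close> units, and both nested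
  loops run over at most \<open>2 * d\<close> positions.\<close>

lemma wp_query_window:
  assumes \<rho>: "delayed d \<rho> \<rho>'" and "live \<rho> t s" and t: "t < length \<rho>" and Q: "\<rho> ! t = Query"
  shows "wp W query_window (\<lambda>k s'. k \<le> 300 + 2 * d * (128 * d + 110) \<and> live \<rho> (Suc t) s' \<and>
    s' ''out'' 0 = max_entry n (matrix_after M (take t \<rho>))) (receive Query s)"
proof -
  let ?N = "matrix_after M (take (Suc t) \<rho>)"
  define lo where "lo = Suc t - d"
  define hi where "hi = min T (Suc t + d)"
  have len: "length \<rho> = T"
    using delayed_length[OF \<rho>] .
  \<comment> \<open>The window is set after the tick, so the argument is carried out at time
    \<open>Suc t\<close>; the query itself leaves the matrix as it was.\<close>
  have N: "matrix_after M (take t \<rho>) = ?N"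
    using Q t apply_request_matrix_after[of Query M "take t \<rho>"] by (simp add: take_Suc_conv_app_nth)
  have lohi: "lo \<le> T" "lo \<le> hi" "hi - lo \<le> 2 * d" "hi \<le> T"
    using t len by (auto simp: lo_def hi_def)
  have pos: "1 \<le> W" "int hi \<le> W" "int lo \<le> W"
    using W_ge lohi by linarith+
  have t': "Suc t \<le> T" using t len by simp
  note le = stored_maxima_le[OF \<rho> t', folded lo_def]
  \<comment> \<open>Two-sided bounds suffice for fitting into a word, so the exact intermediate
    value of \<open>''out''\<close> never has to be tracked.\<close>
  have outW: "\<bar>v\<bar> \<le> W" if "top_max lo \<le> v" "v \<le> max_entry n ?N" for v
    using that max_bounds(3)[of lo] max_entry_bound[of "take (Suc t) \<rho>"] len W_ge by auto
  let ?row = "\<lambda>i. row_max lo i + row_count (take (Suc t) \<rho>) i"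
  let ?col = "\<lambda>i. col_max lo i + col_count (take (Suc t) \<rho>) i"
  \<comment> \<open>Only inequalities are kept: \<open>''out''\<close> lies between the stored
    maximum and the true one and dominates all candidates of the positions already visited. At
    \<open>q = hi\<close> these are the premises of \<open>window_max\<close>.\<close>
  let ?I = "\<lambda>q s. live \<rho> (Suc t) s \<and> s ''lo'' 0 = int lo \<and> s ''hi'' 0 = int hi \<and>
    s ''q'' 0 = int q \<and> top_max lo \<le> s ''out'' 0 \<and> s ''out'' 0 \<le> max_entry n ?N \<and>
    (\<forall>q'\<in>{lo..<q}. ?row (idx q') \<le> s ''out'' 0 \<and> ?col (idx q') \<le> s ''out'' 0 \<and>
      (\<forall>r\<in>{lo..<hi}. ?N (idx q') (idx r) \<le> s ''out'' 0))"
  let ?x = "Read ''pred_index'' (Var ''q'')"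
  let ?e = "current ?x (Read ''pred_index'' (Var ''r''))"
  let ?b = "Less (Var ''q'') (Var ''hi'')"
  let ?c = "block [raise (row_bound ?x), raise (col_bound ?x), Set ''r'' (Var ''lo''),
    raise_loop ''r'' (Var ''hi'') ?e, incr ''q'' (Const 0)]"
  have body: "wp W ?c (\<lambda>k s'. k \<le> 64 * (hi - lo) + 100 \<and> ?I (Suc q) s') s"
    if q: "lo \<le> q" "q < hi" and I: "?I q s" for q s
  proof -
    have pi: "s ''pred_index'' (int r) = int (idx r)" "idx r < n" "int (idx r) \<le> W" "int r \<le> W"
      if "r < hi" for r
      using I that idx(1)[of r] W_ge lohi(4) by (auto simp: live_def static_def)
    note pq = pi[OF q(2)]
    have s: "live \<rho> (Suc t) s" "s ''lo'' 0 = int lo" "s ''hi'' 0 = int hi" "s ''q'' 0 = int q"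
      "top_max lo \<le> s ''out'' 0" "s ''out'' 0 \<le> max_entry n ?N"
      using I by auto
    have row_le: "?row (idx q) \<le> max_entry n ?N" and col_le: "?col (idx q) \<le> max_entry n ?N"
      using le pq(2) by auto
    define v1 where "v1 = max (s ''out'' 0) (?row (idx q))"
    define s1 where "s1 = s(''out'' := (s ''out'')(0 := v1))"
    have v1: "top_max lo \<le> v1" "v1 \<le> max_entry n ?N" "s ''out'' 0 \<le> v1" "?row (idx q) \<le> v1"
      using s row_le by (auto simp: v1_def)
    have ev1: "afits W (row_bound ?x) s \<and> aval (row_bound ?x) s = ?row (idx q)"
      by (rule row_bound_eval[OF s(1) len s(2) lohi(1) pq(2)]) (use s pq pos in simp_all)
    have r1: "wp W (raise (row_bound ?x)) (\<lambda>k s'. k \<le> 36 \<and> s' = s1) s"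
      by (rule wp_mono[OF wp_raise])
        (use ev1 outW[OF s(5,6)] in \<open>simp_all add: s1_def v1_def\<close>)
    have s1: "live \<rho> (Suc t) s1" "s1 ''lo'' 0 = int lo" "s1 ''q'' 0 = int q" "s1 ''out'' 0 = v1"
      "s1 ''pred_index'' = s ''pred_index''"
      using s by (simp_all add: s1_def)
    define v2 where "v2 = max v1 (?col (idx q))"
    define s2 where "s2 = s1(''out'' := (s1 ''out'')(0 := v2))"
    have v2: "top_max lo \<le> v2" "v2 \<le> max_entry n ?N" "v1 \<le> v2" "?col (idx q) \<le> v2"
      using v1 col_le by (auto simp: v2_def)
    have ev2: "afits W (col_bound ?x) s1 \<and> aval (col_bound ?x) s1 = ?col (idx q)"
      by (rule col_bound_eval[OF s1(1) len s1(2) lohi(1) pq(2)]) (use s1 pq pos in simp_all)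
    have r2: "wp W (raise (col_bound ?x)) (\<lambda>k s'. k \<le> 36 \<and> s' = s2) s1"
      by (rule wp_mono[OF wp_raise])
        (use ev2 s1(4) outW[OF v1(1,2)] in \<open>simp_all add: s2_def v2_def\<close>)
    define s3 where "s3 = s2(''r'' := (s2 ''r'')(0 := int lo))"
    have s3: "live \<rho> (Suc t) s3" "s3 ''lo'' 0 = int lo" "s3 ''hi'' 0 = int hi" "s3 ''q'' 0 = int q"
      "s3 ''out'' 0 = v2" "s3 ''pred_index'' = s ''pred_index''" "s3 ''r'' 0 = int lo"
      using s by (simp_all add: s1_def s2_def s3_def)
    define v3 where "v3 = Max (insert v2 ((\<lambda>r. ?N (idx q) (idx r)) ` {lo..<hi}))"
    have v3: "v2 \<le> v3" "\<And>r. r \<in> {lo..<hi} \<Longrightarrow> ?N (idx q) (idx r) \<le> v3"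
      unfolding v3_def by (rule Max_ge; simp)+
    have v3_le: "v3 \<le> max_entry n ?N"
      using v2 entry_le_max_entry[OF pq(2) pi(2), of _ ?N] by (simp add: v3_def)
    have loop: "wp W (raise_loop ''r'' (Var ''hi'') ?e) (\<lambda>k s'. k \<le> (hi - lo) *
        (2 * acost ?e + acost (Var ''hi'') + 20) + acost (Var ''hi'') + 4 \<and>
        s' = s3(''r'' := (s3 ''r'')(0 := int hi), ''out'' := (s3 ''out'')(0 :=
          Max (insert (s3 ''out'' 0) ((\<lambda>r. ?N (idx q) (idx r)) ` {lo..<hi}))))) s3"
    proof (rule wp_raise_loop)
      fix r y assume r: "lo \<le> r" "r < hi"
      let ?s = "s3(''r'' := (s3 ''r'')(0 := int r), ''out'' := (s3 ''out'')(0 := y))"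
      show "afits W ?e ?s \<and> aval ?e ?s = ?N (idx q) (idx r)"
        by (rule current_eval) (use s3 len pi[OF r(2)] pq pos in simp_all)
    qed (use s3 outW[OF v2(1,2)] pos lohi in simp_all)
    note loop = loop[unfolded s3(5), folded v3_def]
    have old: "\<forall>q'\<in>{lo..<q}. ?row (idx q') \<le> s ''out'' 0 \<and> ?col (idx q') \<le> s ''out'' 0 \<and>
      (\<forall>r\<in>{lo..<hi}. ?N (idx q') (idx r) \<le> s ''out'' 0)"
      using I by blast
    have "?row (idx q') \<le> v3 \<and> ?col (idx q') \<le> v3 \<and> (\<forall>r\<in>{lo..<hi}. ?N (idx q') (idx r) \<le> v3)"
      if q': "q' \<in> {lo..<Suc q}" for q'
    proof (cases "q' = q")
      case True
      then show ?thesis using v1 v2 v3 by force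
    next
      case False
      then have "q' \<in> {lo..<q}" using q' by auto
      moreover have "s ''out'' 0 \<le> v3" using v1 v2 v3 by linarith
      ultimately show ?thesis using old by (meson order_trans)
    qed
    then have new: "?I (Suc q) (s3(''r'' := f, ''out'' := (s3 ''out'')(0 := v3),
        ''q'' := (s3 ''q'')(0 := int q + 1)))" for f
      using s3 v3 v3_le v2 by simp
    have tail: "wp W (Set ''r'' (Var ''lo'')) (\<lambda>k3. wp W (raise_loop ''r'' (Var ''hi'') ?e)
        (\<lambda>k4. wp W (incr ''q'' (Const 0)) (\<lambda>k5. wp W Skip
        (\<lambda>k6 s'. k1 + (k2 + (k3 + (k4 + (k5 + k6)))) \<le> 64 * (hi - lo) + 100 \<and> ?I (Suc q) s')))) s2"
      if k: "k1 \<le> 36" "k2 \<le> 36" for k1 k2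
    proof -
      have "wp W (raise_loop ''r'' (Var ''hi'') ?e)
        (\<lambda>k4. wp W (incr ''q'' (Const 0)) (\<lambda>k5. wp W Skip
        (\<lambda>k6 s'. k1 + (k2 + (4 + (k4 + (k5 + k6)))) \<le> 64 * (hi - lo) + 100 \<and> ?I (Suc q) s'))) s3"
      proof (rule wp_mono[OF loop])
        fix k4 s4
        assume 4: "k4 \<le> (hi - lo) * (2 * acost ?e + acost (Var ''hi'') + 20) + acost (Var ''hi'') + 4 \<and>
          s4 = s3(''r'' := (s3 ''r'')(0 := int hi), ''out'' := (s3 ''out'')(0 := v3))"
        have "s4 ''q'' 0 = int q" "int q + 1 \<le> W"
          using 4 s3(4) q(2) pos by auto
        moreover have "?I (Suc q) (s4(''q'' := (s4 ''q'')(0 := int q + 1)))"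
          using new[of "(s3 ''r'')(0 := int hi)"] 4 by simp
        moreover have "k1 + (k2 + (4 + (k4 + (6 + 1)))) \<le> 64 * (hi - lo) + 100"
          using 4 k by simp
        ultimately show "wp W (incr ''q'' (Const 0)) (\<lambda>k5. wp W Skip
          (\<lambda>k6 s'. k1 + (k2 + (4 + (k4 + (k5 + k6)))) \<le> 64 * (hi - lo) + 100 \<and> ?I (Suc q) s')) s4"
          using pos by (simp add: wp_simps)
      qed
      moreover have "s2 ''lo'' 0 = int lo"
        using s by (simp add: s1_def s2_def)
      ultimately show ?thesis
        using pos by (simp add: wp_Assign s3_def)
    qed
    show ?thesis
      unfolding block.simps wp_Seq
      by (rule wp_mono[OF r1], elim conjE, hypsubst, rule wp_mono[OF r2], elim conjE, hypsubst,
          rule tail)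
  qed
  have loop: "wp W (While ?b ?c) (\<lambda>k s'. k \<le> (hi - lo) * ((64 * (hi - lo) + 100) + tcost ?b + 1) +
      tcost ?b + 1 \<and> ?I hi s') s" if "?I lo s" for s
  proof (rule wp_While[where I = ?I])
    show "?I lo s" by fact
    show "lo \<le> hi" by fact
    show "tfits W ?b s \<and> \<not> tval ?b s" if "?I hi s" for s
      using that pos by simp
    show "tfits W ?b s \<and> tval ?b s \<and> wp W ?c (\<lambda>k s'. k \<le> 64 * (hi - lo) + 100 \<and> ?I (Suc q) s') s"
      if "lo \<le> q" "q < hi" "?I q s" for q s
      using body[OF that] that pos by simp
  qed
  have start: "wp W (Set ''out'' (Read ''top'' (Var ''lo''))) (\<lambda>k3. wp W (While ?b ?c)
      (\<lambda>k4. wp W Skip (\<lambda>k5 s'. k1 + (k2 + (k3 + (k4 + k5))) \<le> 300 + 2 * d * (128 * d + 110) \<and>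
        live \<rho> (Suc t) s' \<and> s' ''out'' 0 = max_entry n ?N))) s2"
    if k: "k1 \<le> 10" "k2 \<le> 50" and s2: "live \<rho> (Suc t) s2" "s2 ''lo'' 0 = int lo"
      "s2 ''hi'' 0 = int hi" "s2 ''q'' 0 = int lo" for k1 k2 s2
  proof -
    define s3 where "s3 = s2(''out'' := (s2 ''out'')(0 := top_max lo))"
    have top: "s2 ''top'' (int lo) = top_max lo"
      using s2(1) lohi(1) by (simp add: live_def tables_def)
    have "?I lo s3"
      using s2 le(3) by (simp add: s3_def)
    note loop = loop[OF this]
    have "wp W (While ?b ?c) (\<lambda>k4. wp W Skip (\<lambda>k5 s'. k1 + (k2 + (5 + (k4 + k5))) \<le>
      300 + 2 * d * (128 * d + 110) \<and> live \<rho> (Suc t) s' \<and> s' ''out'' 0 = max_entry n ?N)) s3"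
    proof (rule wp_mono[OF loop])
      fix k s'
      assume s': "k \<le> (hi - lo) * ((64 * (hi - lo) + 100) + tcost ?b + 1) + tcost ?b + 1 \<and> ?I hi s'"
      have "s' ''out'' 0 = max_entry n ?N"
        by (rule window_max[OF \<rho> t', folded lo_def hi_def]) (use s' in auto)
      \<comment> \<open>\<open>106\<close> is the \<open>100\<close> units allotted to the body
        outside its inner loop iterations plus \<open>6\<close> for the outer test.\<close>
      moreover have "(hi - lo) * (106 + 64 * (hi - lo)) \<le> 2 * d * (128 * d + 110)"
        using lohi(3) by (intro mult_mono) auto
      then have "k \<le> 2 * d * (128 * d + 110) + 10"
        using s' by simp
      ultimately show "wp W Skip (\<lambda>k5 s'. k1 + (k2 + (5 + (k + k5))) \<le>
          300 + 2 * d * (128 * d + 110) \<and> live \<rho> (Suc t) s' \<and> s' ''out'' 0 = max_entry n ?N) s'"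
        using s' k by (simp add: wp_Skip)
    qed
    then show ?thesis
      using s2(2) pos top outW[OF order_refl le(3)] by (simp add: wp_Assign s3_def)
  qed
  show ?thesis
    unfolding query_window_def block.simps(2)[of tick] block.simps(2)[of set_window]
      block.simps(2)[of "Set _ _"] block.simps(2)[of "While _ _"] block.simps(1) wp_Seq N
  proof (rule wp_mono[OF wp_tick[OF assms(2) t len Q]])
    fix k1 :: nat and s1
    assume 1: "k1 \<le> 10 \<and> live \<rho> (Suc t) s1 \<and> s1 ''out'' = s ''out''"
    show "wp W set_window (\<lambda>k2. wp W (Set ''out'' (Read ''top'' (Var ''lo''))) (\<lambda>k3.
      wp W (While ?b ?c) (\<lambda>k4. wp W Skip (\<lambda>k5 s'. k1 + (k2 + (k3 + (k4 + k5))) \<le>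
        300 + 2 * d * (128 * d + 110) \<and> live \<rho> (Suc t) s' \<and> s' ''out'' 0 = max_entry n ?N)))) s1"
    proof (rule wp_mono[OF wp_set_window[of \<rho> "Suc t" s1, folded lo_def hi_def]])
      show "live \<rho> (Suc t) s1" "Suc t \<le> T" using 1 t' by auto
    qed (rule start; use 1 in simp)
  qed
qed

end

section \<open>Whole request sequences, word size and growth rates\<close>

text \<open>The invariant keeps the answer in \<open>''out''\<close> at all times, so a query merely
  advances the clock.\<close>

lemma serves_update_maximum:
  assumes "erickson n d B M \<rho>' W" "delayed d \<rho> \<rho>'" "erickson.live n d M \<rho>' \<rho> 0 s"
    "s ''out'' 0 = max_entry n M"
  shows "serves W update_maximum tick (1000 * real (max 1 d)) 1000 n M s \<rho>"
proof -
  interpret erickson n d B M \<rho>' W by fact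
  let ?Inv = "\<lambda>t s. live \<rho> t s \<and> s ''out'' 0 = max_entry n (matrix_after M (take t \<rho>))"
  show ?thesis
  proof (rule serves_invariant[where Inv = ?Inv])
    show "?Inv 0 s"
      using assms by (simp add: matrix_after_def row_count_def col_count_def)
  next
    fix t s assume t: "t < length \<rho>" and I: "?Inv t s" and Q: "\<rho> ! t = Query"
    have "matrix_after M (take (Suc t) \<rho>) = matrix_after M (take t \<rho>)"
      using Q t apply_request_matrix_after[of Query M "take t \<rho>"]
      by (simp add: take_Suc_conv_app_nth)
    then show "wp W tick (\<lambda>k s'. real k \<le> 1000 \<and>
        s' ''out'' 0 = max_entry n (matrix_after M (take t \<rho>)) \<and> ?Inv (Suc t) s') (receive Query s)"
      using I by (intro wp_mono[OF wp_tick[OF _ t delayed_length[OF assms(2)] Q]]) auto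
  next
    fix t s assume t: "t < length \<rho>" and I: "?Inv t s" and Q: "\<rho> ! t \<noteq> Query"
    show "wp W update_maximum (\<lambda>k s'. real k \<le> 1000 * real (max 1 d) \<and> ?Inv (Suc t) s')
        (receive (\<rho> ! t) s)"
      using I by (intro wp_mono[OF wp_update_maximum[OF assms(2) _ t Q]]) auto
  qed
qed

text \<open>Here updates only count and the invariant is silent about \<open>''out''\<close>, which
  every query recomputes.\<close>

lemma serves_query_window:
  assumes "erickson n d B M \<rho>' W" "delayed d \<rho> \<rho>'" "erickson.live n d M \<rho>' \<rho> 0 s"
  shows "serves W count_request query_window 1000 (1000 * real (max 1 d) ^ 2) n M s \<rho>"
proof -
  interpret erickson n d B M \<rho>' W by fact
  have bound: "real k \<le> 1000 * real (max 1 d) ^ 2" if "k \<le> 300 + 2 * d * (128 * d + 110)" for k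
  proof -
    have "d \<le> max 1 d ^ 2" "d * d \<le> max 1 d ^ 2" "1 \<le> max 1 d ^ 2"
      by (cases "d = 0"; auto simp: max_def power2_eq_square)+
    moreover have "2 * d * (128 * d + 110) = 256 * (d * d) + 220 * d"
      by (simp add: algebra_simps)
    ultimately have "k \<le> 1000 * max 1 d ^ 2"
      using that by linarith
    then have "real k \<le> real (1000 * max 1 d ^ 2)"
      by (rule of_nat_mono)
    then show ?thesis by simp
  qed
  show ?thesis
  proof (rule serves_invariant[where Inv = "live \<rho>"])
    show "live \<rho> 0 s" by fact
  next
    fix t s assume t: "t < length \<rho>" and I: "live \<rho> t s" and Q: "\<rho> ! t = Query"
    show "wp W query_window (\<lambda>k s'. real k \<le> 1000 * real (max 1 d) ^ 2 \<and>
        s' ''out'' 0 = max_entry n (matrix_after M (take t \<rho>)) \<and> live \<rho> (Suc t) s')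
        (receive Query s)"
      by (rule wp_mono[OF wp_query_window[OF assms(2) I t Q]]) (use bound in blast)
  next
    fix t s assume t: "t < length \<rho>" and I: "live \<rho> t s" and Q: "\<rho> ! t \<noteq> Query"
    have "valid_request n (\<rho> ! t)"
      using valid delayed_set[OF assms(2)] t nth_mem by metis
    then show "wp W count_request (\<lambda>k s'. real k \<le> 1000 \<and> live \<rho> (Suc t) s') (receive (\<rho> ! t) s)"
      by (intro wp_mono[OF wp_count_request[OF I t delayed_length[OF assms(2)] Q]]) auto
  qed
qed

text \<open>With \<open>N = n + d + B\<close>, the exponent \<open>k + 2\<close> dominates both
  \<open>k + 1\<close>, from \<open>T * n\<close>, and \<open>2\<close>, from \<open>n * n\<close>.
  The terms with \<open>T\<close> contribute \<open>3 * k\<close> to the coefficient, the others at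
  most \<open>6\<close>.\<close>

lemma word_size_bound:
  fixes T k n d B :: nat
  assumes "T \<le> k * n ^ k" "1 \<le> n"
  defines "K \<equiv> 3 * k + 6"
  shows "B + d + 2 * T + 2 + n * n + (T + 1) * n \<le> K * (n + d + B) ^ K"
proof -
  define N where "N = n + d + B"
  let ?X = "N ^ (k + 2)"
  have N: "1 \<le> N" "n \<le> N" using assms by (auto simp: N_def)
  have pow: "N ^ j \<le> ?X" if "j \<le> k + 2" for j
    using N that by (intro power_increasing) auto
  have "n ^ k \<le> N ^ k"
    using N by (intro power_mono) auto
  then have T: "T \<le> k * N ^ k"
    using assms(1) by (meson mult_le_mono2 order_trans)
  have 1: "2 * T \<le> 2 * k * ?X"
    using T mult_le_mono2[OF pow[of k], of k] by linarith
  have "T * n \<le> k * N ^ k * N"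
    using T N by (intro mult_mono) auto
  moreover have "k * N ^ k * N = k * N ^ (k + 1)"
    by simp
  ultimately have 2: "T * n \<le> k * ?X"
    using mult_le_mono2[OF pow[of "k + 1"], of k] by linarith
  have "n * n \<le> N ^ 2"
    unfolding power2_eq_square using N by (intro mult_mono) auto
  also have "N ^ 2 \<le> ?X"
    by (rule pow) simp
  finally have 3: "n * n \<le> ?X" .
  have 4: "N \<le> ?X" "1 \<le> ?X"
    using pow[of 1] N by simp_all
  have "B + d + 2 * T + 2 + n * n + (T + 1) * n \<le> (3 * k + 6) * ?X"
    using 1 2 3 4 N unfolding N_def by (simp add: algebra_simps)
  also have "\<dots> \<le> K * N ^ K"
    using N unfolding K_def by (intro mult_mono power_increasing) auto
  finally show ?thesis unfolding N_def .
qed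

definition preprocessing_time :: "nat \<Rightarrow> nat \<Rightarrow> nat" where
  "preprocessing_time T n = (T + 1) * (n * (96 * n + 148) + 108) + 30"

text \<open>The common frame of both variants: they share the preprocessing and the word size and
  differ only in the handlers.\<close>

lemma solves_erickson_preprocess:
  fixes k :: nat
  assumes T: "\<And>n. 1 \<le> n \<Longrightarrow> T n \<le> k * n ^ k"
    and serves: "\<And>n d B M \<rho> \<rho>' W s. erickson n d B M \<rho>' W \<Longrightarrow> delayed d \<rho> \<rho>' \<Longrightarrow>
      erickson.live n d M \<rho>' \<rho> 0 s \<Longrightarrow> s ''out'' 0 = max_entry n M \<Longrightarrow>
      serves W upd qry (U n d) (Q n d) n M s \<rho>"
  shows "solves_erickson T preprocess upd qry (\<lambda>n. real (preprocessing_time (T n) n)) U Q"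
  unfolding solves_erickson_def Let_def
proof (rule exI[of _ "3 * k + 6"], intro allI impI)
  fix n d B :: nat and M :: matrix and \<rho>' :: "request list"
  let ?W = "int ((3 * k + 6) * (n + d + B) ^ (3 * k + 6))"
  assume n: "1 \<le> n" and asm: "(\<forall>i<n. \<forall>j<n. \<bar>M i j\<bar> \<le> int B) \<and> length \<rho>' = T n \<and>
    (\<forall>r\<in>set \<rho>'. valid_request n r)"
  have er: "erickson n d B M \<rho>' ?W"
    using word_size_bound[OF T[OF n] n, of B d] asm n
    by unfold_locales (auto simp del: of_nat_add of_nat_mult of_nat_power)
  obtain l s where "exec ?W preprocess (input_state n d M \<rho>') l s"
      "l \<le> preprocessing_time (T n) n" "\<forall>\<rho>. erickson.live n d M \<rho>' \<rho> 0 s"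
      "s ''out'' 0 = max_entry n M"
    using erickson.wp_preprocess[OF er] asm unfolding wp_def preprocessing_time_def by auto
  then show "\<exists>l s. exec ?W preprocess (input_state n d M \<rho>') l s \<and>
      real l \<le> real (preprocessing_time (T n) n) \<and>
      (\<forall>\<rho>. delayed d \<rho> \<rho>' \<longrightarrow> serves ?W upd qry (U n d) (Q n d) n M s \<rho>)"
    using serves[OF er] by (meson of_nat_mono)
qed

text \<open>\<open>polynomially_bounded\<close> uses one number as factor and as exponent, so the
  true exponent \<open>k + 2\<close> is inflated to \<open>400 * (k + 1)\<close>. The factor comes
  from \<open>352 = 96 + 148 + 108\<close>, with room for the additive \<open>30\<close>.\<close>

lemma polynomially_bounded_preprocessing_time:
  fixes k :: nat
  assumes T: "\<And>n. 1 \<le> n \<Longrightarrow> T n \<le> k * n ^ k"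
  shows "polynomially_bounded (\<lambda>n. real (preprocessing_time (T n) n))"
  unfolding polynomially_bounded_def
proof (intro exI[of _ "400 * (k + 1)"] allI impI)
  fix n :: nat assume n: "1 \<le> n"
  have p: "1 \<le> n ^ k" using n by simp
  have "T n + 1 \<le> (k + 1) * n ^ k"
    using T[OF n] p by simp
  moreover have nn: "1 \<le> n ^ 2" "n \<le> n ^ 2"
    using n by (auto simp: power2_eq_square)
  have "n * (96 * n + 148) = 96 * n ^ 2 + 148 * n"
    by (simp add: algebra_simps power2_eq_square)
  with nn have "n * (96 * n + 148) + 108 \<le> 352 * n ^ 2"
    by linarith
  ultimately have "preprocessing_time (T n) n \<le> (k + 1) * n ^ k * (352 * n ^ 2) + 30"
    unfolding preprocessing_time_def by (intro add_mono mult_mono) auto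
  also have "\<dots> \<le> 400 * ((k + 1) * n ^ (k + 2))"
  proof -
    have "1 \<le> (k + 1) * n ^ (k + 2)"
      using n by (simp add: Suc_le_eq)
    moreover have "(k + 1) * n ^ k * (352 * n ^ 2) = 352 * ((k + 1) * n ^ (k + 2))"
      by (simp only: power_add mult_ac)
    ultimately show ?thesis by linarith
  qed
  also have "\<dots> \<le> 400 * ((k + 1) * n ^ (400 * (k + 1)))"
    using n by (intro mult_left_mono power_increasing) auto
  finally have "real (preprocessing_time (T n) n) \<le> real (400 * ((k + 1) * n ^ (400 * (k + 1))))"
    by (rule of_nat_mono)
  then show "real (preprocessing_time (T n) n) \<le> real (400 * (k + 1)) * real n ^ (400 * (k + 1))"
    by (simp only: of_nat_mult of_nat_power mult.assoc)
qed

theorem theorem8p25: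
  fixes T :: "nat \<Rightarrow> nat"
  assumes "polynomially_bounded (\<lambda>n. real (T n))"
  shows "(\<exists>pre upd qry P U Q. solves_erickson T pre upd qry P U Q \<and>
            polynomially_bounded P \<and>
            U \<in> soft_O (\<lambda>n d. real (max 1 d)) \<and>
            Q \<in> soft_O (\<lambda>n d. 1))
       \<and> (\<exists>pre upd qry P U Q. solves_erickson T pre upd qry P U Q \<and>
            polynomially_bounded P \<and>
            U \<in> soft_O (\<lambda>n d. 1) \<and>
            Q \<in> soft_O (\<lambda>n d. real (max 1 d) ^ 2))"
proof -
  obtain k :: nat where "\<And>n. 1 \<le> n \<Longrightarrow> real (T n) \<le> real k * real n ^ k"
    using assms unfolding polynomially_bounded_def by blast
  then have k: "T n \<le> k * n ^ k" if "1 \<le> n" for n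
    using that by (metis of_nat_le_iff of_nat_mult of_nat_power)
  have P: "polynomially_bounded (\<lambda>n. real (preprocessing_time (T n) n))"
    by (rule polynomially_bounded_preprocessing_time) (rule k)
  \<comment> \<open>The bounds hold outright with the constant \<open>1000\<close>, so the power of
    the logarithm is taken to be \<open>0\<close>.\<close>
  have soft_O: "(\<lambda>n d. 1000 * g n d) \<in> soft_O g" for g
    unfolding soft_O_def by (intro CollectI exI[of _ "1000::real"] exI[of _ "0::nat"]) simp
  have "solves_erickson T preprocess update_maximum tick (\<lambda>n. real (preprocessing_time (T n) n))
      (\<lambda>n d. 1000 * real (max 1 d)) (\<lambda>n d. 1000 * 1)"
    by (rule solves_erickson_preprocess[OF k]) (simp_all only: mult_1_right serves_update_maximum)
  moreover have "solves_erickson T preprocess count_request query_window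
      (\<lambda>n. real (preprocessing_time (T n) n)) (\<lambda>n d. 1000 * 1) (\<lambda>n d. 1000 * real (max 1 d) ^ 2)"
    by (rule solves_erickson_preprocess[OF k]) (simp_all only: mult_1_right serves_query_window)
  ultimately show ?thesis
    using P soft_O[of "\<lambda>n d. real (max 1 d)"] soft_O[of "\<lambda>n d. 1"]
      soft_O[of "\<lambda>n d. real (max 1 d) ^ 2"] by blast
qed

end
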